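(* Let $\varphi\in A_\infty(\Omega)$ be a Musielak–Orlicz function of uniformly lower type $p_\varphi^-$ and uniformly upper type $p_\varphi^+$ with $q(\varphi)<p_\varphi^-\le p_\varphi^+<\infty$. Then for every $r\in(1,\infty)$ there is $C>0$ such that for every sequence $(g_k)_{k\in\mathbb N}$ of nonnegative $\mathcal F$-measurable functions, $$\Big\|\Big\{\sum_{k\in\mathbb N}[\mathbb E_k(g_k)]^r\Big\}^{1/r}\Big\|_{L^\varphi(\Omega)}\le C\Big\|\Big(\sum_{k\in\mathbb N}g_k^r\Big)^{1/r}\Big\|_{L^\varphi(\Omega)}.$$
   Context: Let $(\Omega,\mathcal F,\mathbb P)$ be a probability space, $(\mathcal F_n)_{n\in\mathbb Z_+}$ a nondecreasing sequence of sub-$\sigma$-algebras of $\mathcal F$, and $\mathbb E_n$ the conditional expectation w.r.t. $\mathcal F_n$. A Musielak–Orlicz function is $\varphi:\Omega\times[0,\infty)\to[0,\infty)$ with $\varphi(x,\cdot)$ nondecreasing, $\varphi(x,0)=0$, $\lim_{t\to\infty}\varphi(x,t)=\infty$ for each $x$ and $\varphi(\cdot,t)$ measurable (positive, integrable) for each $t$. $\|f\|_{L^\varphi(\Omega)}:=\inf\{\lambda>0:\int_\Omega\varphi(x,|f(x)|/\lambda)\,d\mathbb P\le1\}$. Uniformly lower (upper) type $p$: $\varphi(x,st)\le Cs^p\varphi(x,t)$ for all $x$, $t\ge0$, $s\in(0,1)$ (resp. $s\ge1$). For $q>1$, $\varphi\in A_q(\Omega)$ if $\sup_{t>0}\mathbb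 E_n(\varphi(\cdot,t))[\mathbb E_n(\varphi(\cdot,t)^{-1/(q-1)})]^{q-1}\le K$ a.e. for all $n$; $\varphi\in A_1(\Omega)$ if $\sup_{t>0}\mathbb E_n(\varphi(\cdot,t))/\varphi(\cdot,t)\le K$ a.e.; $A_\infty(\Omega)=\bigcup_{q\ge1}A_q(\Omega)$; $q(\varphi):=\inf\{q\ge1:\varphi\in A_q(\Omega)\}$. *)

theory Defs
  imports "HOL-Probability.Probability"
begin

text \<open>Real power on extended nonnegative reals (used only with positive exponents):
  \<open>\<infinity>\<close> is mapped to \<open>\<infinity>\<close>.\<close>
definition enn_rpow :: "ennreal \<Rightarrow> real \<Rightarrow> ennreal" where
  "enn_rpow t a = (if t = \<infinity> then \<infinity> else ennreal (enn2real t powr a))"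

definition musielak_orlicz :: "'a measure \<Rightarrow> ('a \<Rightarrow> real \<Rightarrow> real) \<Rightarrow> bool" where
  "musielak_orlicz M \<phi> \<longleftrightarrow>
     (\<forall>x\<in>space M. mono_on {0..} (\<phi> x)) \<and>
     (\<forall>x\<in>space M. \<phi> x 0 = 0) \<and>
     (\<forall>x\<in>space M. filterlim (\<phi> x) at_top at_top) \<and>
     (\<forall>x\<in>space M. \<forall>t\<ge>0. 0 \<le> \<phi> x t) \<and>
     (\<forall>t\<ge>0. (\<lambda>x. \<phi> x t) \<in> borel_measurable M) \<and>
     (\<forall>t>0. \<forall>x\<in>space M. 0 < \<phi> x t) \<and>
     (\<forall>t\<ge>0. integrable M (\<lambda>x. \<phi> x t))"

definition unif_lower_type :: "'a measure \<Rightarrow> ('a \<Rightarrow> real \<Rightarrow> real) \<Rightarrow> real \<Rightarrow> bool" where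
  "unif_lower_type M \<phi> p \<longleftrightarrow> (\<exists>C>0. \<forall>x\<in>space M. \<forall>t s. 0 \<le> t \<longrightarrow> 0 < s \<longrightarrow> s < 1 \<longrightarrow>
      \<phi> x (s * t) \<le> C * s powr p * \<phi> x t)"

definition unif_upper_type :: "'a measure \<Rightarrow> ('a \<Rightarrow> real \<Rightarrow> real) \<Rightarrow> real \<Rightarrow> bool" where
  "unif_upper_type M \<phi> p \<longleftrightarrow> (\<exists>C>0. \<forall>x\<in>space M. \<forall>t s. 0 \<le> t \<longrightarrow> 1 \<le> s \<longrightarrow>
      \<phi> x (s * t) \<le> C * s powr p * \<phi> x t)"

text \<open>Muckenhoupt-type classes relative to the filtration F (conditional expectations
  \<open>E_n\<close> are nn_cond_exp).  The condition ``sup over t > 0 bounded by K a.e.'' is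
  read as: for each t > 0, a.e. bounded by K (uniformly in t).\<close>
definition MO_A :: "'a measure \<Rightarrow> (nat \<Rightarrow> 'a measure) \<Rightarrow> real \<Rightarrow> ('a \<Rightarrow> real \<Rightarrow> real) \<Rightarrow> bool" where
  "MO_A M F q \<phi> \<longleftrightarrow>
     (if q = 1 then
        (\<exists>K. \<forall>n. \<forall>t>0. AE x in M.
           nn_cond_exp M (F n) (\<lambda>y. ennreal (\<phi> y t)) x \<le> ennreal K * ennreal (\<phi> x t))
      else q > 1 \<and>
        (\<exists>K. \<forall>n. \<forall>t>0. AE x in M.
           nn_cond_exp M (F n) (\<lambda>y. ennreal (\<phi> y t)) x *
           enn_rpow (nn_cond_exp M (F n) (\<lambda>y. ennreal (\<phi> y t powr (- 1 / (q - 1)))) x) (q - 1)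
             \<le> ennreal K))"

definition MO_A_infty :: "'a measure \<Rightarrow> (nat \<Rightarrow> 'a measure) \<Rightarrow> ('a \<Rightarrow> real \<Rightarrow> real) \<Rightarrow> bool" where
  "MO_A_infty M F \<phi> \<longleftrightarrow> (\<exists>q\<ge>1. MO_A M F q \<phi>)"

definition crit_index :: "'a measure \<Rightarrow> (nat \<Rightarrow> 'a measure) \<Rightarrow> ('a \<Rightarrow> real \<Rightarrow> real) \<Rightarrow> real" where
  "crit_index M F \<phi> = Inf {q. 1 \<le> q \<and> MO_A M F q \<phi>}"

definition MO_ext :: "('a \<Rightarrow> real \<Rightarrow> real) \<Rightarrow> 'a \<Rightarrow> ennreal \<Rightarrow> ennreal" where
  "MO_ext \<phi> x t = (if t = \<infinity> then \<infinity> else ennreal (\<phi> x (enn2real t)))"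

text \<open>Luxemburg (quasi-)norm of a nonnegative extended-valued function;
  it is \<open>\<infinity>\<close> if no admissible c exists.\<close>
definition lux_norm :: "'a measure \<Rightarrow> ('a \<Rightarrow> real \<Rightarrow> real) \<Rightarrow> ('a \<Rightarrow> ennreal) \<Rightarrow> ennreal" where
  "lux_norm M \<phi> f = Inf {ennreal c | c. 0 < c \<and>
      (\<integral>\<^sup>+ x. MO_ext \<phi> x (f x / ennreal c) \<partial>M) \<le> 1}"

end

theory Submission
  imports Defs
begin

text \<open>
  For fixed \<open>t\<close> the function \<open>w = \<phi>(\<cdot>, t)\<close> is an \<open>A\<^sub>s\<close> weight, for one exponent \<open>s\<close> below the lower
  type and one above the upper type, with a constant independent of \<open>t\<close>. It therefore suffices to
  prove the vector-valued weak type \<open>(s, s)\<close> inequality for \<open>A\<^sub>s\<close> weights and to interpolate: at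
  level \<open>2\<^sup>j\<close> the sequence \<open>g\<close> is cut according to whether \<open>f = (\<Sum> g\<^sub>k\<^sup>r)\<^bsup>1/r\<^esup>\<close> exceeds \<open>2\<^sup>j\<close>, and the
  weak type bounds for the weight \<open>\<phi>(\<cdot>, 2\<^sup>j)\<close> are summed over \<open>j\<close>.

  The weighted inequality is extrapolated from the case \<open>s = r\<close>, which is Hoelder's inequality, with
  the maximal function \<open>\<M>\<close> as the auxiliary weight. Write \<open>\<sigma> = w\<^bsup>-1/(s-1)\<^esup>\<close> and
  \<open>S = \<Sum> (E\<^sub>k g\<^sub>k)\<^sup>r\<close>. If \<open>s < r\<close>, then \<open>S \<le> K (\<M> f)\<^bsup>r-s\<^esup> \<Sum> E\<^sub>k(g\<^sub>k\<^sup>r f\<^bsup>s-r\<^esup> w) / E\<^sub>k w\<close>, and \<open>\<M>\<close> is bounded on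
  \<open>L\<^sup>s(w)\<close>. If \<open>r < s\<close>, then for every \<open>h \<ge> 0\<close> and \<open>\<theta> = (s-r)/(s-1)\<close> one has
  \<open>\<integral> S h\<^sup>\<theta> w \<le> K\<^bsup>1-\<theta>\<^esup> \<integral> f\<^sup>r (\<M>(hw))\<^sup>\<theta> w\<^bsup>1-\<theta>\<^esup>\<close>; taking \<open>h\<close> to be a power of a truncation of \<open>S\<close> and using
  that \<open>\<M>\<close> is bounded on the dual space \<open>L\<^bsup>s'\<^esup>(\<sigma>)\<close>, the inequality closes by absorption.
\<close>

subsection \<open>Powers of extended nonnegative reals and the inequality of Hoelder\<close>

notation enn_rpow (infixr "powe" 80)

lemma ennreal_powe: "0 \<le> x \<Longrightarrow> ennreal x powe a = ennreal (x powr a)"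
  by (simp add: enn_rpow_def)

lemma top_powe [simp]: "(top::ennreal) powe a = top" "(\<infinity>::ennreal) powe a = \<infinity>"
  by (simp_all add: enn_rpow_def)

lemma zero_powe [simp]: "0 powe a = 0"
  by (simp add: enn_rpow_def)

lemma one_powe [simp]: "1 powe a = 1"
  by (simp add: enn_rpow_def)

lemma powe_one [simp]: "x powe 1 = x"
  by (cases x) (simp_all add: ennreal_powe)

lemma powe_eq_0_iff [simp]: "x powe a = 0 \<longleftrightarrow> x = 0"
  by (cases x) (auto simp: ennreal_powe)

lemma powe_eq_top_iff [simp]: "x powe a = top \<longleftrightarrow> x = top"
  by (cases x) (auto simp: ennreal_powe)

lemma powe_less_top_iff [simp]: "x powe a < top \<longleftrightarrow> x < top"
  by (simp add: less_top[symmetric])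

lemma powe_mono: "0 \<le> a \<Longrightarrow> x \<le> y \<Longrightarrow> x powe a \<le> y powe a"
  by (cases x; cases y) (auto simp: ennreal_powe top_unique intro!: powr_mono2)

lemma powe_mult: "(x * y) powe a = x powe a * y powe a"
proof (cases "x = 0 \<or> y = 0")
  case False
  then show ?thesis
    by (cases x; cases y)
       (auto simp: ennreal_powe powr_mult ennreal_mult[symmetric] ennreal_mult_top ennreal_top_mult)
qed auto

lemma powe_powe: "(x powe a) powe b = x powe (a * b)"
  by (cases x) (simp_all add: ennreal_powe powr_powr)

lemma powe_add: "x powe (a + b) = x powe a * x powe b"
  by (cases x) (simp_all add: ennreal_powe powr_add ennreal_mult)

lemma powe_le_iff: "0 < a \<Longrightarrow> x powe a \<le> y powe a \<longleftrightarrow> x \<le> y"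
  using powe_mono[of a x y] powe_mono[of "1 / a" "x powe a" "y powe a"] by (auto simp: powe_powe)

lemma powe_inverse_cancel [simp]:
  "a \<noteq> 0 \<Longrightarrow> (x powe a) powe (1 / a) = x" "a \<noteq> 0 \<Longrightarrow> (x powe (1 / a)) powe a = x"
  by (simp_all add: powe_powe)

lemma powe_le_swap: "0 < a \<Longrightarrow> x powe a \<le> y \<longleftrightarrow> x \<le> y powe (1 / a)"
  using powe_le_iff[of "1 / a" "x powe a" y] by simp

lemma powe_sum_le: "0 < a \<Longrightarrow> (x + y) powe a \<le> ennreal (2 powr a) * (x powe a + y powe a)"
proof -
  assume a: "0 < a"
  have "(x + y) powe a \<le> (2 * max x y) powe a"
    using a by (intro powe_mono) (auto simp: mult_2 intro!: add_mono)
  also have "\<dots> = ennreal (2 powr a) * (max x y powe a)"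
    using ennreal_powe[of 2 a] by (simp add: powe_mult)
  also have "\<dots> \<le> ennreal (2 powr a) * (x powe a + y powe a)"
    by (intro mult_left_mono) (auto simp: max_def)
  finally show ?thesis .
qed

lemma borel_measurable_powe [measurable]:
  assumes [measurable]: "f \<in> borel_measurable M"
  shows "(\<lambda>x. f x powe a) \<in> borel_measurable M"
  unfolding enn_rpow_def by measurable

lemma ennreal_divide_mult_cancel: "y \<noteq> 0 \<Longrightarrow> y \<noteq> top \<Longrightarrow> x / y * y = (x::ennreal)"
  by (simp add: ennreal_divide_times ennreal_divide_self less_top[symmetric])

lemma powe_divide:
  assumes "y \<noteq> 0" "y \<noteq> top"
  shows "(x / y) powe a = x powe a / y powe a"
proof -
  have "(x / y) powe a * y powe a = x powe a"
    using assms by (simp flip: powe_mult add: ennreal_divide_mult_cancel)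
  then show ?thesis
    using assms mult_divide_eq_ennreal[of "y powe a" "(x / y) powe a"] by simp
qed

lemma powe_young:
  assumes ab: "0 < a" "0 < b" "a + b = 1"
  shows "x powe a * y powe b \<le> ennreal a * x + ennreal b * y"
proof (cases "x = 0 \<or> y = 0 \<or> x = top \<or> y = top")
  case True
  then show ?thesis using ab by (auto simp: ennreal_mult_top)
next
  case False
  then obtain u v where uv: "x = ennreal u" "y = ennreal v" "0 < u" "0 < v"
    by (cases x; cases y) auto
  have "u powr a * v powr b \<le> a * u + b * v"
    using ab uv by (intro Youngs_inequality_0) auto
  then show ?thesis
    using ab uv by (simp add: ennreal_powe flip: ennreal_mult ennreal_plus)
qed

text \<open>Dividing \<open>f\<close> and \<open>g\<close> by their integrals reduces the claim to
  Young's inequality. The degenerate cases are settled first: a vanishing integral makes the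
  integrand zero almost everywhere, and otherwise an infinite one makes the right-hand side
  infinite.\<close>

lemma nn_integral_Hoelder:
  assumes ab: "0 < a" "0 < b" "a + b = 1"
    and [measurable]: "f \<in> borel_measurable M" "g \<in> borel_measurable M"
  shows "(\<integral>\<^sup>+x. f x powe a * g x powe b \<partial>M) \<le> (\<integral>\<^sup>+x. f x \<partial>M) powe a * (\<integral>\<^sup>+x. g x \<partial>M) powe b"
    (is "?L \<le> ?X powe a * ?Y powe b")
proof (cases "?X = 0 \<or> ?Y = 0")
  case True
  then have "(AE x in M. f x = 0) \<or> (AE x in M. g x = 0)"
    by (simp add: nn_integral_0_iff_AE)
  then have "AE x in M. f x powe a * g x powe b = 0" by auto
  then have "?L = 0" by (simp add: nn_integral_0_iff_AE)
  then show ?thesis by simp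
next
  case False
  show ?thesis
  proof (cases "?X = top \<or> ?Y = top")
    case True
    then show ?thesis using False by (auto simp: ennreal_mult_top ennreal_top_mult)
  next
    case fin: False
    let ?R = "?X powe a * ?Y powe b"
    have pw: "f x powe a * g x powe b \<le> ?R * (ennreal a * (f x / ?X) + ennreal b * (g x / ?Y))" for x
    proof -
      have "f x powe a * g x powe b = (f x / ?X * ?X) powe a * (g x / ?Y * ?Y) powe b"
        using False fin by (simp add: ennreal_divide_mult_cancel)
      also have "\<dots> = ?R * ((f x / ?X) powe a * (g x / ?Y) powe b)"
        by (simp only: powe_mult mult_ac)
      also have "\<dots> \<le> ?R * (ennreal a * (f x / ?X) + ennreal b * (g x / ?Y))"
        by (intro mult_left_mono powe_young ab) auto
      finally show ?thesis .
    qed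
    have "?L \<le> (\<integral>\<^sup>+x. ?R * (ennreal a * (f x / ?X) + ennreal b * (g x / ?Y)) \<partial>M)"
      by (intro nn_integral_mono pw)
    also have "\<dots> = ?R * (ennreal a * (?X / ?X) + ennreal b * (?Y / ?Y))"
      by (simp add: nn_integral_cmult nn_integral_add nn_integral_divide)
    also have "\<dots> = ?R"
    proof -
      have "?X / ?X = 1" "?Y / ?Y = 1" "ennreal a + ennreal b = 1"
        using False fin ab by (auto simp: ennreal_divide_self less_top simp flip: ennreal_plus)
      then show ?thesis by simp
    qed
    finally show ?thesis .
  qed
qed

text \<open>Finiteness of \<open>X\<close> allows the factor \<open>X powe (1 - a)\<close> to be
  cancelled, after which the power \<open>1 / a\<close> is taken. This closes the estimate in
  \<open>vector_strong_above\<close>, where the unknown integral occurs on both sides.\<close>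

lemma powe_absorb:
  assumes "0 < a" "a < 1" "X \<noteq> top" "X \<le> C * Y powe a * X powe (1 - a)"
  shows "X \<le> C powe (1 / a) * Y"
proof (cases "X = 0")
  case False
  have "X powe a * X powe (1 - a) \<le> (C * Y powe a) * X powe (1 - a)"
    using assms(4) by (simp flip: powe_add)
  then have "X powe a \<le> C * Y powe a"
    using False assms(3) ennreal_mult_le_mult_iff[of "X powe (1 - a)" "X powe a" "C * Y powe a"]
    by (simp only: mult.commute[of _ "X powe (1 - a)"]) simp
  then show ?thesis
    using assms(1) powe_le_swap[of a X "C * Y powe a"] by (simp add: powe_mult)
qed simp

text \<open>Together with the next two lemmas, this gathers all powers of a positive weight into one
  real exponent, so that an identity between weights becomes one between exponents.\<close>

lemma weight_powe: "0 < w \<Longrightarrow> ennreal (w powr a) powe b = ennreal (w powr (a * b))"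
  by (simp add: ennreal_powe powr_powr)

lemma weight_mult: "0 < w \<Longrightarrow> ennreal (w powr a) * ennreal (w powr b) = ennreal (w powr (a + b))"
  by (simp add: powr_add ennreal_mult)

lemma weight_one: "0 < w \<Longrightarrow> ennreal w = ennreal (w powr 1)"
  by simp

section \<open>Conditional Hoelder inequality with extended values\<close>

context sigma_finite_subalgebra
begin

text \<open>The set where the conditional expectation vanishes belongs to \<open>F\<close>, so
  \<open>f\<close> has integral zero over it.\<close>

lemma nn_cond_exp_eq_0_imp:
  assumes [measurable]: "f \<in> borel_measurable M"
  shows "AE x in M. nn_cond_exp M F f x = 0 \<longrightarrow> f x = 0"
proof -
  define B where "B = {x \<in> space F. nn_cond_exp M F f x = 0}"
  have [measurable]: "B \<in> sets F" unfolding B_def by measurable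
  have [measurable]: "B \<in> sets M" using subalg \<open>B \<in> sets F\<close> by (auto simp: subalgebra_def)
  have "(\<integral>\<^sup>+x. indicator B x * f x \<partial>M) = (\<integral>\<^sup>+x. indicator B x * nn_cond_exp M F f x \<partial>M)"
    by (rule nn_cond_exp_intg[symmetric]) auto
  also have "\<dots> = 0"
  proof -
    have "indicator B x * nn_cond_exp M F f x = 0" for x
      by (simp add: B_def split: split_indicator)
    then show ?thesis by (simp only: nn_integral_const) simp
  qed
  finally have "AE x in M. indicator B x * f x = 0"
    by (simp add: nn_integral_0_iff_AE)
  moreover have "space F = space M" using subalg by (simp add: subalgebra_def)
  ultimately show ?thesis by (auto simp: B_def indicator_def split: if_splits)
qed

text \<open>On the \<open>F\<close>-measurable set \<open>B\<close> where the conditional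
  expectation of \<open>f\<close> is zero, \<open>f\<close> and hence \<open>h\<close> vanish almost
  everywhere, and the indicator of \<open>B\<close> passes through the conditional expectation of
  \<open>h\<close>. This covers the case in which one factor of the Hoelder bound is zero while the
  other may be infinite.\<close>

lemma nn_cond_exp_vanish:
  assumes [measurable]: "f \<in> borel_measurable M" "h \<in> borel_measurable M"
    and h: "\<And>x. f x = 0 \<Longrightarrow> h x = 0"
  shows "AE x in M. nn_cond_exp M F f x = 0 \<longrightarrow> nn_cond_exp M F h x = 0"
proof -
  define B where "B = {x \<in> space F. nn_cond_exp M F f x = 0}"
  have [measurable]: "B \<in> sets F" unfolding B_def by measurable
  have [measurable]: "B \<in> sets M" using subalg \<open>B \<in> sets F\<close> by (auto simp: subalgebra_def)
  have sp: "space F = space M" using subalg by (simp add: subalgebra_def)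
  have "AE x in M. indicator B x * h x = 0"
    using nn_cond_exp_eq_0_imp[OF assms(1)] h by (auto simp: B_def indicator_def)
  then have "AE x in M. nn_cond_exp M F (\<lambda>x. indicator B x * h x) x = nn_cond_exp M F (\<lambda>x. 0) x"
    by (intro nn_cond_exp_cong) auto
  moreover have "AE x in M. 0 = nn_cond_exp M F (\<lambda>x. 0) x"
    by (rule nn_cond_exp_F_meas) auto
  moreover have "AE x in M. indicator B x * nn_cond_exp M F h x
    = nn_cond_exp M F (\<lambda>x. indicator B x * h x) x"
    by (rule nn_cond_exp_prod) auto
  ultimately show ?thesis
    using AE_space by eventually_elim (auto simp: B_def indicator_def sp split: if_splits)
qed

text \<open>Young's inequality is applied after normalising by the conditional expectations
  \<open>X\<close> and \<open>Y\<close>. These are measurable for \<open>F\<close>, so they act as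
  constants under the conditional expectation.\<close>

lemma nn_cond_exp_Hoelder:
  assumes ab: "0 < a" "0 < b" "a + b = 1"
    and [measurable]: "f \<in> borel_measurable M" "g \<in> borel_measurable M"
  shows "AE x in M. nn_cond_exp M F (\<lambda>x. f x powe a * g x powe b) x
            \<le> nn_cond_exp M F f x powe a * nn_cond_exp M F g x powe b"
proof -
  define X where "X = nn_cond_exp M F f"
  define Y where "Y = nn_cond_exp M F g"
  define Z where "Z = nn_cond_exp M F (\<lambda>x. f x powe a * g x powe b)"
  define R where "R = (\<lambda>x. X x powe a * Y x powe b)"
  \<comment> \<open>Off \<open>D\<close> at least one of the two conditional expectations is
    infinite, and the bound is then trivial unless the other one is zero.\<close>
  define D where "D = {x \<in> space F. X x \<noteq> top \<and> Y x \<noteq> top}"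
  have [measurable]: "X \<in> borel_measurable F" "Y \<in> borel_measurable F" "Z \<in> borel_measurable F"
    by (auto simp: X_def Y_def Z_def)
  have [measurable]: "R \<in> borel_measurable F" unfolding R_def by measurable
  have [measurable]: "D \<in> sets F" unfolding D_def by measurable
  have FM: "h \<in> borel_measurable M" if "h \<in> borel_measurable F" for h :: "'a \<Rightarrow> ennreal"
    using that by (rule measurable_from_subalg[OF subalg])
  have sp: "space F = space M" using subalg by (simp add: subalgebra_def)
  \<comment> \<open>The coefficients of \<open>f\<close> and \<open>g\<close> in Young's inequality,
    cut off to \<open>D\<close>. Where \<open>X\<close> and \<open>Y\<close> are positive and
    finite, \<open>c * X + d * Y\<close> equals \<open>R\<close> because
    \<open>a + b = 1\<close>.\<close>
  define c where "c = (\<lambda>x. indicator D x * (R x * ennreal a / X x))"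
  define d where "d = (\<lambda>x. indicator D x * (R x * ennreal b / Y x))"
  have cF [measurable]: "c \<in> borel_measurable F" "d \<in> borel_measurable F" 
    unfolding c_def d_def by measurable
  note [measurable] = FM[OF cF(1)] FM[OF cF(2)]
  have iD: "(indicator D :: 'a \<Rightarrow> ennreal) \<in> borel_measurable F" by measurable
  note [measurable] = FM[OF iD]
  have pw: "AE x in M. indicator D x * (f x powe a * g x powe b) \<le> c x * f x + d x * g x"
    using nn_cond_exp_eq_0_imp[OF assms(4)] nn_cond_exp_eq_0_imp[OF assms(5)]
  proof eventually_elim
    case (elim x)
    show ?case
    proof (cases "x \<in> D \<and> X x \<noteq> 0 \<and> Y x \<noteq> 0")
      case True
      then have fin: "X x \<noteq> top" "Y x \<noteq> top" by (auto simp: D_def)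
      have "f x powe a * g x powe b = (f x / X x * X x) powe a * (g x / Y x * Y x) powe b"
        using True fin by (simp add: ennreal_divide_mult_cancel)
      also have "\<dots> = R x * ((f x / X x) powe a * (g x / Y x) powe b)"
        by (simp only: powe_mult mult_ac R_def)
      also have "\<dots> \<le> R x * (ennreal a * (f x / X x) + ennreal b * (g x / Y x))"
        by (intro mult_left_mono powe_young ab) auto
      also have "\<dots> = c x * f x + d x * g x"
        using True by (simp add: c_def d_def divide_ennreal_def algebra_simps)
      finally show ?thesis using True by simp
    next
      case False
      then show ?thesis using elim by (auto simp: X_def Y_def)
    qed
  qed
  have "AE x in M. nn_cond_exp M F (\<lambda>x. indicator D x * (f x powe a * g x powe b)) x
           \<le> nn_cond_exp M F (\<lambda>x. c x * f x + d x * g x) x"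
    by (rule nn_cond_exp_mono[OF pw]) measurable
  moreover have "AE x in M. indicator D x * Z x
      = nn_cond_exp M F (\<lambda>x. indicator D x * (f x powe a * g x powe b)) x"
    unfolding Z_def by (rule nn_cond_exp_prod) auto
  moreover have "AE x in M. nn_cond_exp M F (\<lambda>x. c x * f x) x + nn_cond_exp M F (\<lambda>x. d x * g x) x
       = nn_cond_exp M F (\<lambda>x. c x * f x + d x * g x) x"
    by (rule nn_cond_exp_sum) auto
  moreover have "AE x in M. c x * X x = nn_cond_exp M F (\<lambda>x. c x * f x) x"
    unfolding X_def by (rule nn_cond_exp_prod) auto
  moreover have "AE x in M. d x * Y x = nn_cond_exp M F (\<lambda>x. d x * g x) x"
    unfolding Y_def by (rule nn_cond_exp_prod) auto
  moreover have "AE x in M. X x = 0 \<longrightarrow> Z x = 0"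
    unfolding X_def Z_def by (rule nn_cond_exp_vanish) auto
  moreover have "AE x in M. Y x = 0 \<longrightarrow> Z x = 0"
    unfolding Y_def Z_def by (rule nn_cond_exp_vanish) auto
  ultimately have "AE x in M. Z x \<le> R x"
    using AE_space
  proof eventually_elim
    case (elim x)
    show ?case
    proof (cases "X x = 0 \<or> Y x = 0")
      case True then show ?thesis using elim by auto
    next
      case nz: False
      show ?thesis
      proof (cases "x \<in> D")
        case True
        then have fin: "X x \<noteq> top" "Y x \<noteq> top" by (auto simp: D_def)
        have "Z x \<le> c x * X x + d x * Y x" using elim True by simp
        also have "\<dots> = R x * (ennreal a + ennreal b)"
          using True nz fin by (simp add: c_def d_def ennreal_divide_mult_cancel distrib_left)
        also have "\<dots> = R x" using ab by (simp flip: ennreal_plus)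
        finally show ?thesis .
      next
        case False
        then show ?thesis using nz elim by (auto simp: D_def R_def sp ennreal_mult_top ennreal_top_mult)
      qed
    qed
  qed
  then show ?thesis by (simp add: X_def Y_def Z_def R_def)
qed

end

subsection \<open>Dyadic interpolation in Musielak--Orlicz classes\<close>

text \<open>A measurable substitute for \<open>MO_ext \<phi> x t\<close>: since \<open>\<phi> x\<close> is only monotone, \<open>x \<mapsto> \<phi> x (f x)\<close> need
  not be measurable.\<close>

definition dyadic_modular :: "('a \<Rightarrow> real \<Rightarrow> real) \<Rightarrow> 'a \<Rightarrow> ennreal \<Rightarrow> ennreal" where
  "dyadic_modular \<phi> x t =
     (\<integral>\<^sup>+(j::int). ennreal (\<phi> x (2 powr j)) * indicator {ennreal (2 powr j)<..} t \<partial>count_space UNIV)"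

text \<open>An enumeration of the integers turns the integral over the counting measure into a
  series of measurable functions.\<close>

lemma borel_measurable_dyadic_modular:
  assumes meas: "\<And>t. 0 < t \<Longrightarrow> (\<lambda>x. \<phi> x t) \<in> borel_measurable M"
    and [measurable]: "X \<in> borel_measurable M"
  shows "(\<lambda>x. dyadic_modular \<phi> x (X x)) \<in> borel_measurable M"
proof -
  have [measurable]: "\<And>j::int. (\<lambda>x. \<phi> x (2 powr j)) \<in> borel_measurable M" by (rule meas) auto
  show ?thesis
    unfolding dyadic_modular_def
    using bij_betw_from_nat_into[of "UNIV :: int set"]
    by (subst nn_integral_bij_count_space[of "from_nat_into UNIV" UNIV UNIV, symmetric])
       (auto simp: nn_integral_count_space_nat)
qed

text \<open>The integral of a non-measurable \<open>\<Phi>\<close> is its lower integral, to which the usual rule for constant factors does not apply.\<close>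

lemma nn_integral_le_cmult:
  fixes h \<Phi> :: "'a \<Rightarrow> ennreal"
  assumes [measurable]: "h \<in> borel_measurable M" and C: "0 < C"
    and le: "AE x in M. h x \<le> ennreal C * \<Phi> x"
  shows "(\<integral>\<^sup>+x. h x \<partial>M) \<le> ennreal C * (\<integral>\<^sup>+x. \<Phi> x \<partial>M)"
proof -
  have [simp]: "ennreal C / ennreal C = 1" using C by (simp add: ennreal_divide_self)
  have "AE x in M. h x / ennreal C \<le> \<Phi> x"
    using le
  proof eventually_elim
    case (elim x)
    then have "h x / ennreal C \<le> ennreal C * \<Phi> x / ennreal C" by (rule divide_right_mono_ennreal)
    also have "\<dots> = \<Phi> x" using C mult_divide_eq_ennreal[of "ennreal C" "\<Phi> x"] by (simp add: mult.commute)
    finally show ?case .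
  qed
  then have "(\<integral>\<^sup>+x. h x / ennreal C \<partial>M) \<le> (\<integral>\<^sup>+x. \<Phi> x \<partial>M)" by (rule nn_integral_mono_AE)
  then have "ennreal C * ((\<integral>\<^sup>+x. h x \<partial>M) / ennreal C) \<le> ennreal C * (\<integral>\<^sup>+x. \<Phi> x \<partial>M)"
    by (intro mult_left_mono) (simp_all add: nn_integral_divide)
  then show ?thesis
    using C by (simp add: mult.commute[of "ennreal C" "_ / _"] ennreal_divide_mult_cancel)
qed

section \<open>Geometric sums over dyadic levels\<close>

lemma dyadic_interval:
  fixes u :: real
  assumes "0 < u"
  obtains J :: int where "2 powr J < u" "u \<le> 2 powr (J + 1)"
proof -
  \<comment> \<open>The shift by one makes the interval open at its left end, so that level
    \<open>J\<close> lies strictly below \<open>u\<close>, as the strict indicator in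
    \<open>dyadic_modular\<close> requires.\<close>
  define J where "J = \<lceil>log 2 u\<rceil> - 1"
  have "real_of_int J < log 2 u" "log 2 u \<le> real_of_int J + 1"
    unfolding J_def by linarith+
  then have "2 powr J < u" "u \<le> 2 powr (J + 1)"
    using assms by (simp_all add: less_log_iff log_le_iff)
  then show thesis using that by blast
qed

lemma geometric_int_sum:
  fixes a :: real
  assumes "0 < a"
  shows "(\<integral>\<^sup>+(i::int). ennreal (2 powr (- a * i)) * indicator {0::int..} i \<partial>count_space UNIV)
           = ennreal (1 / (1 - 2 powr (- a)))"
proof -
  have bij: "bij_betw int UNIV {0..}"
    by (auto simp: bij_betw_def image_def intro: nonneg_int_cases)
  have "(\<integral>\<^sup>+(i::int). ennreal (2 powr (- a * i)) * indicator {0::int..} i \<partial>count_space UNIV)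
     = (\<integral>\<^sup>+i. ennreal (2 powr (- a * real_of_int i)) \<partial>count_space {0..})"
    by (simp add: nn_integral_count_space_indicator)
  also have "\<dots> = (\<integral>\<^sup>+n. ennreal (2 powr (- a * real_of_int (int n))) \<partial>count_space UNIV)"
    by (rule nn_integral_bij_count_space[OF bij, symmetric])
  also have "\<dots> = (\<Sum>n. ennreal ((2 powr (- a)) ^ n))"
    by (simp add: nn_integral_count_space_nat powr_powr flip: powr_realpow)
  also have "\<dots> = ennreal (\<Sum>n. (2 powr (- a)) ^ n)"
    using assms by (intro suminf_ennreal2 summable_geometric) (auto simp: powr_minus_divide)
  also have "(\<Sum>n. (2 powr (- a)) ^ n) = 1 / (1 - 2 powr (- a))"
    using assms by (intro suminf_geometric) (auto simp: powr_minus_divide)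
  finally show ?thesis .
qed

text \<open>For finite positive \<open>t\<close> the single level just below \<open>t\<close>
  suffices, since the upper type at ratio \<open>2\<close> controls the growth over one dyadic step.
  For infinite \<open>t\<close> all levels count, and those of nonnegative index contribute at least
  \<open>\<phi> x 1 > 0\<close> each.\<close>

lemma MO_ext_le_dyadic_modular:
  assumes mono: "mono_on {0..} (\<phi> x)" and zero: "\<phi> x 0 = 0" and pos: "\<And>t. 0 < t \<Longrightarrow> 0 < \<phi> x t"
    and upper: "\<And>t s. 0 \<le> t \<Longrightarrow> 1 \<le> s \<Longrightarrow> \<phi> x (s * t) \<le> c * s powr p * \<phi> x t"
    and "0 < c"
  shows "MO_ext \<phi> x t \<le> ennreal (c * 2 powr p) * dyadic_modular \<phi> x t"
proof (cases "t = top")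
  case True
  have "top = ennreal (\<phi> x 1) * emeasure (count_space UNIV) {0::int..}"
    using pos[of 1] by (simp add: infinite_Ici ennreal_mult_top)
  also have "\<dots> = (\<integral>\<^sup>+(j::int). ennreal (\<phi> x 1) * indicator {0..} j \<partial>count_space UNIV)"
    by (simp add: nn_integral_cmult)
  also have "\<dots> \<le> dyadic_modular \<phi> x t"
    unfolding dyadic_modular_def
  proof (intro nn_integral_mono)
    fix j :: int
    have "\<phi> x 1 \<le> \<phi> x (2 powr j)" if "0 \<le> j"
      using that by (intro mono_onD[OF mono]) (auto simp: ge_one_powr_ge_zero)
    then show "ennreal (\<phi> x 1) * indicator {0..} j
        \<le> ennreal (\<phi> x (2 powr j)) * indicator {ennreal (2 powr j)<..} t"
      using True by (auto simp: indicator_def intro!: ennreal_leI)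
  qed
  finally show ?thesis using \<open>0 < c\<close> by (simp add: top_unique ennreal_mult_top)
next
  case False
  show ?thesis
  proof (cases "t = 0")
    case True
    then show ?thesis using zero by (simp add: MO_ext_def)
  next
    case nz: False
    obtain u where u: "t = ennreal u" "0 < u" using False nz by (cases t) auto
    obtain J :: int where J: "2 powr J < u" "u \<le> 2 powr (J + 1)" using dyadic_interval[OF u(2)] .
    have "\<phi> x u \<le> \<phi> x (2 * 2 powr J)"
      using J u by (intro mono_onD[OF mono]) (auto simp: powr_add)
    also have "\<dots> \<le> c * 2 powr p * \<phi> x (2 powr J)" by (rule upper) auto
    finally have "ennreal (\<phi> x u) \<le> ennreal (c * 2 powr p) * ennreal (\<phi> x (2 powr J))"
      using \<open>0 < c\<close> by (simp add: ennreal_leI flip: ennreal_mult')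
    also have "ennreal (\<phi> x (2 powr J)) \<le> dyadic_modular \<phi> x t"
      unfolding dyadic_modular_def
      using nn_integral_ge_point[of J UNIV "\<lambda>j. ennreal (\<phi> x (2 powr real_of_int j)) *
        indicator {ennreal (2 powr real_of_int j)<..} t"]
        J u by (auto simp: ennreal_less_iff)
    finally show ?thesis using u by (simp add: MO_ext_def mult_left_mono)
  qed
qed

text \<open>Only levels up to the dyadic position \<open>J\<close> of \<open>t\<close> contribute.
  The lower type leaves the factor \<open>(2 powr j / u) powr (p - s1)\<close>, which decays
  geometrically as \<open>j\<close> decreases from \<open>J\<close> because
  \<open>s1 < p\<close>.\<close>

lemma dyadic_sum_below:
  assumes nn: "\<And>t. 0 \<le> t \<Longrightarrow> 0 \<le> \<phi> x t"
    and lower: "\<And>t s. 0 \<le> t \<Longrightarrow> 0 < s \<Longrightarrow> s < 1 \<Longrightarrow> \<phi> x (s * t) \<le> c * s powr p * \<phi> x t"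
    and c: "0 < c" and s1: "s1 < p" and t: "t \<noteq> top"
  shows "(\<integral>\<^sup>+(j::int). ennreal (2 powr (- s1 * j)) *
           (t powe s1 * indicator {ennreal (2 powr j)<..} t *
             ennreal (\<phi> x (2 powr j))) \<partial>count_space UNIV)
          \<le> ennreal (c / (1 - 2 powr (s1 - p))) * MO_ext \<phi> x t" (is "?L \<le> _")
proof (cases "t = 0")
  case False
  obtain u where u: "t = ennreal u" "0 < u" using t False by (cases t) auto
  obtain J :: int where J: "2 powr J < u" "u \<le> 2 powr (J + 1)" using dyadic_interval[OF u(2)] .
  let ?g = "\<lambda>i::int. ennreal (2 powr (- (p - s1) * i)) * indicator {0::int..} i"
  have summand: "ennreal (2 powr (- s1 * j)) *
           (t powe s1 * indicator {ennreal (2 powr j)<..} t * ennreal (\<phi> x (2 powr j)))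
        \<le> ennreal (c * \<phi> x u) * ?g (J - j)" for j :: int
  proof (cases "2 powr j < u")
    case True
    have "2 powr (real_of_int j) < 2 powr (real_of_int (J + 1))" using True J by linarith
    then have jJ: "j \<le> J" by simp
    have "2 powr (- s1 * j) * (u powr s1 * \<phi> x (2 powr j))
       \<le> 2 powr (- s1 * j) * (u powr s1 * (c * (2 powr j / u) powr p * \<phi> x u))"
      using lower[of u "2 powr j / u"] u True by (intro mult_left_mono) auto
    also have "\<dots> = (2 powr j / u) powr (p - s1) * (c * \<phi> x u)"
      using u by (simp add: powr_divide powr_diff powr_powr powr_minus field_simps)
    also have "\<dots> \<le> (2 powr (real_of_int j - J)) powr (p - s1) * (c * \<phi> x u)"
      using u J s1 nn[of u] c by (intro mult_right_mono powr_mono2) (auto simp: powr_diff field_simps)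
    also have "\<dots> = c * \<phi> x u * 2 powr (- (p - s1) * (J - j))"
      by (simp add: powr_powr algebra_simps)
    finally show ?thesis
      using jJ True u c nn[of u] nn[of "2 powr j"]
      by (simp add: ennreal_less_iff ennreal_powe ennreal_leI flip: ennreal_mult' ennreal_mult'')
  next
    case False
    then show ?thesis using u by (simp add: ennreal_less_iff)
  qed
  have bij: "bij_betw (\<lambda>j. J - j) UNIV (UNIV :: int set)"
    by (rule bij_betwI[where g="\<lambda>j. J - j"]) auto
  have "?L \<le> (\<integral>\<^sup>+j. ennreal (c * \<phi> x u) * ?g (J - j) \<partial>count_space UNIV)"
    by (intro nn_integral_mono summand)
  also have "\<dots> = ennreal (c * \<phi> x u) * (\<integral>\<^sup>+j. ?g (J - j) \<partial>count_space UNIV)"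
    by (rule nn_integral_cmult) simp
  also have "(\<integral>\<^sup>+j. ?g (J - j) \<partial>count_space UNIV) = (\<integral>\<^sup>+j. ?g j \<partial>count_space UNIV)"
    by (rule nn_integral_bij_count_space[OF bij])
  also have "\<dots> = ennreal (1 / (1 - 2 powr (- (p - s1))))"
    by (rule geometric_int_sum) (use s1 in auto)
  finally show ?thesis
    using u c nn[of u] s1 by (simp add: MO_ext_def powr_less_one mult.commute flip: ennreal_mult'
      ennreal_mult'')
qed simp

text \<open>Mirror image of \<open>dyadic_sum_below\<close>: the upper type leaves the factor
  \<open>(u / 2 powr j) powr (s2 - p)\<close>, which decays as \<open>j\<close> increases because
  \<open>p < s2\<close>.\<close>

lemma dyadic_sum_above:
  assumes nn: "\<And>t. 0 \<le> t \<Longrightarrow> 0 \<le> \<phi> x t"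
    and upper: "\<And>t s. 0 \<le> t \<Longrightarrow> 1 \<le> s \<Longrightarrow> \<phi> x (s * t) \<le> c * s powr p * \<phi> x t"
    and c: "0 < c" and s2: "p < s2" and t: "t \<noteq> top"
  shows "(\<integral>\<^sup>+(j::int). ennreal (2 powr (- s2 * j)) *
           (t powe s2 * indicator {..ennreal (2 powr j)} t *
             ennreal (\<phi> x (2 powr j))) \<partial>count_space UNIV)
          \<le> ennreal (c / (1 - 2 powr (p - s2))) * MO_ext \<phi> x t" (is "?L \<le> _")
proof (cases "t = 0")
  case False
  obtain u where u: "t = ennreal u" "0 < u" using t False by (cases t) auto
  obtain J :: int where J: "2 powr J < u" "u \<le> 2 powr (J + 1)" using dyadic_interval[OF u(2)] .
  let ?g = "\<lambda>i::int. ennreal (2 powr (- (s2 - p) * i)) * indicator {0::int..} i"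
  \<comment> \<open>The first level not below \<open>u\<close> is \<open>J + 1\<close>, hence the
    shift in \<open>j - J - 1\<close>.\<close>
  have summand: "ennreal (2 powr (- s2 * j)) *
           (t powe s2 * indicator {..ennreal (2 powr j)} t * ennreal (\<phi> x (2 powr j)))
        \<le> ennreal (c * \<phi> x u) * ?g (j - J - 1)" for j :: int
  proof (cases "u \<le> 2 powr j")
    case True
    have "2 powr (real_of_int J) < 2 powr (real_of_int j)" using True J by linarith
    then have jJ: "J + 1 \<le> j" by simp
    have "2 powr (- s2 * j) * (u powr s2 * \<phi> x (2 powr j))
       \<le> 2 powr (- s2 * j) * (u powr s2 * (c * (2 powr j / u) powr p * \<phi> x u))"
      using upper[of u "2 powr j / u"] u True by (intro mult_left_mono) auto
    also have "\<dots> = (u / 2 powr j) powr (s2 - p) * (c * \<phi> x u)"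
      using u by (simp add: powr_divide powr_diff powr_powr powr_minus field_simps)
    also have "\<dots> \<le> (2 powr (real_of_int J + 1 - j)) powr (s2 - p) * (c * \<phi> x u)"
      using u J s2 nn[of u] c by (intro mult_right_mono powr_mono2) (auto simp: powr_diff field_simps)
    also have "\<dots> = c * \<phi> x u * 2 powr (- (s2 - p) * (j - J - 1))"
      by (simp add: powr_powr algebra_simps)
    finally show ?thesis
      using jJ True u c nn[of u] nn[of "2 powr j"]
      by (simp add: ennreal_le_iff ennreal_powe ennreal_leI flip: ennreal_mult' ennreal_mult'')
  next
    case False
    then show ?thesis using u by (simp add: ennreal_le_iff)
  qed
  have bij: "bij_betw (\<lambda>j. j - J - 1) UNIV (UNIV :: int set)"
    by (rule bij_betwI[where g="\<lambda>j. j + J + 1"]) auto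
  have "?L \<le> (\<integral>\<^sup>+j. ennreal (c * \<phi> x u) * ?g (j - J - 1) \<partial>count_space UNIV)"
    by (intro nn_integral_mono summand)
  also have "\<dots> = ennreal (c * \<phi> x u) * (\<integral>\<^sup>+j. ?g (j - J - 1) \<partial>count_space UNIV)"
    by (rule nn_integral_cmult) simp
  also have "(\<integral>\<^sup>+j. ?g (j - J - 1) \<partial>count_space UNIV) = (\<integral>\<^sup>+j. ?g j \<partial>count_space UNIV)"
    by (rule nn_integral_bij_count_space[OF bij])
  also have "\<dots> = ennreal (1 / (1 - 2 powr (- (s2 - p))))"
    by (rule geometric_int_sum) (use s2 in auto)
  finally show ?thesis
    using u c nn[of u] s2 by (simp add: MO_ext_def powr_less_one mult.commute flip: ennreal_mult'
      ennreal_mult'')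
qed simp

text \<open>The summation step of Marcinkiewicz interpolation. The assumed bound holds level by
  level; after Tonelli, the sums over the levels below and not below the value of \<open>f\<close>
  are geometric at each point.\<close>

lemma dyadic_interpolation:
  fixes \<phi> :: "'a \<Rightarrow> real \<Rightarrow> real" and X f :: "'a \<Rightarrow> ennreal"
  assumes nn: "\<And>x t. x \<in> space M \<Longrightarrow> 0 \<le> t \<Longrightarrow> 0 \<le> \<phi> x t"
    and lower: "\<And>x t s. x \<in> space M \<Longrightarrow> 0 \<le> t \<Longrightarrow> 0 < s \<Longrightarrow> s < 1 \<Longrightarrow>
        \<phi> x (s * t) \<le> c1 * s powr p1 * \<phi> x t"
    and upper: "\<And>x t s. x \<in> space M \<Longrightarrow> 0 \<le> t \<Longrightarrow> 1 \<le> s \<Longrightarrow> \<phi> x (s * t) \<le> c2 * s powr p2 * \<phi> x t"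
    and c: "0 < c1" "0 < c2" and s: "s1 < p1" "p2 < s2"
    and meas [measurable]: "\<And>t. 0 < t \<Longrightarrow> (\<lambda>x. \<phi> x t) \<in> borel_measurable M"
    and [measurable]: "X \<in> borel_measurable M" "f \<in> borel_measurable M"
    and fin: "AE x in M. f x \<noteq> top" and A: "0 < A"
    and weak: "\<And>j::int. (\<integral>\<^sup>+x. ennreal (\<phi> x (2 powr j)) * indicator {ennreal (2 powr j)<..} (X x) \<partial>M)
        \<le> ennreal A * (
          ennreal (2 powr (- s1 * j)) *
            (\<integral>\<^sup>+x. f x powe s1 * indicator {ennreal (2 powr j)<..} (f x) *
              ennreal (\<phi> x (2 powr j)) \<partial>M) +
          ennreal (2 powr (- s2 * j)) *
            (\<integral>\<^sup>+x. f x powe s2 * indicator {..ennreal (2 powr j)} (f x) * ennreal (\<phi> x (2 powr j)) \<partial>M))"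
  shows "(\<integral>\<^sup>+x. dyadic_modular \<phi> x (X x) \<partial>M)
     \<le> ennreal (A * (c1 / (1 - 2 powr (s1 - p1)) + c2 / (1 - 2 powr (p2 - s2)))) *
        (\<integral>\<^sup>+x. MO_ext \<phi> x (f x) \<partial>M)"
proof -
  let ?T1 = "\<lambda>(j::int) x. ennreal (2 powr (- s1 * j)) *
       (f x powe s1 * indicator {ennreal (2 powr j)<..} (f x) * ennreal (\<phi> x (2 powr j)))"
  let ?T2 = "\<lambda>(j::int) x. ennreal (2 powr (- s2 * j)) *
       (f x powe s2 * indicator {..ennreal (2 powr j)} (f x) * ennreal (\<phi> x (2 powr j)))"
  let ?a = "c1 / (1 - 2 powr (s1 - p1))" and ?b = "c2 / (1 - 2 powr (p2 - s2))"
  have ab: "0 < ?a" "0 < ?b" using c s by (auto simp: powr_less_one)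
  have [measurable]: "\<And>j::int. (\<lambda>x. \<phi> x (2 powr j)) \<in> borel_measurable M" by (rule meas) auto
  have [measurable]: "?T1 j \<in> borel_measurable M" "?T2 j \<in> borel_measurable M" for j by measurable
  have "(\<integral>\<^sup>+x. dyadic_modular \<phi> x (X x) \<partial>M) =
     (\<integral>\<^sup>+(j::int). \<integral>\<^sup>+x. ennreal (\<phi> x (2 powr j)) *
       indicator {ennreal (2 powr j)<..} (X x) \<partial>M \<partial>count_space UNIV)"
    unfolding dyadic_modular_def by (rule nn_integral_count_space_nn_integral) auto
  also have "\<dots> \<le> (\<integral>\<^sup>+j. \<integral>\<^sup>+x. ennreal A * (?T1 j x + ?T2 j x) \<partial>M \<partial>count_space UNIV)"
    using weak by (intro nn_integral_mono[of "count_space UNIV"]) (simp add: nn_integral_cmult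
      nn_integral_add)
  also have "\<dots> = (\<integral>\<^sup>+x. \<integral>\<^sup>+j. ennreal A * (?T1 j x + ?T2 j x) \<partial>count_space UNIV \<partial>M)"
    by (rule nn_integral_count_space_nn_integral[symmetric]) auto
  also have "\<dots> \<le> ennreal (A * (?a + ?b)) * (\<integral>\<^sup>+x. MO_ext \<phi> x (f x) \<partial>M)"
  proof (rule nn_integral_le_cmult)
    show "(\<lambda>x. \<integral>\<^sup>+j. ennreal A * (?T1 j x + ?T2 j x) \<partial>count_space UNIV) \<in> borel_measurable M"
      using bij_betw_from_nat_into[of "UNIV :: int set"]
      by (subst nn_integral_bij_count_space[of "from_nat_into UNIV" UNIV UNIV, symmetric])
         (auto simp: nn_integral_count_space_nat)
    show "0 < A * (?a + ?b)" using A ab by auto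
    show "AE x in M. (\<integral>\<^sup>+j. ennreal A * (?T1 j x + ?T2 j x) \<partial>count_space UNIV)
             \<le> ennreal (A * (?a + ?b)) * MO_ext \<phi> x (f x)"
      using fin AE_space
    proof eventually_elim
      case (elim x)
      have "(\<integral>\<^sup>+j. ennreal A * (?T1 j x + ?T2 j x) \<partial>count_space UNIV)
         = ennreal A * ((\<integral>\<^sup>+j. ?T1 j x \<partial>count_space UNIV) + (\<integral>\<^sup>+j. ?T2 j x \<partial>count_space UNIV))"
        by (simp add: nn_integral_cmult nn_integral_add)
      also have "\<dots> \<le> ennreal A * (ennreal ?a * MO_ext \<phi> x (f x) + ennreal ?b * MO_ext \<phi> x (f x))"
        using elim nn lower upper c s
        by (intro mult_left_mono add_mono dyadic_sum_below dyadic_sum_above) auto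
      also have "\<dots> = ennreal (A * (?a + ?b)) * MO_ext \<phi> x (f x)"
        using A ab by (simp add: ennreal_mult distrib_right mult.assoc)
      finally show ?case .
    qed
  qed
  finally show ?thesis .
qed

subsection \<open>The weighted maximal inequality of Doob\<close>

locale filtered_prob_space = prob_space M for M :: "'a measure" +
  fixes F :: "nat \<Rightarrow> 'a measure"
  assumes subalg: "subalgebra M (F n)"
    and filt: "filtration (space M) F"
begin

abbreviation ce :: "nat \<Rightarrow> ('a \<Rightarrow> ennreal) \<Rightarrow> 'a \<Rightarrow> ennreal"
  where "ce n \<equiv> nn_cond_exp M (F n)"

lemma sigma_finite_subalgebra_F: "sigma_finite_subalgebra M (F n)"
  using subalg by (intro finite_measure_subalgebra_is_sigma_finite)
    (simp add: finite_measure_subalgebra_def finite_measure_axioms finite_measure_subalgebra_axioms_def)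

lemmas ce_intg = sigma_finite_subalgebra.nn_cond_exp_intg[OF sigma_finite_subalgebra_F]
  and ce_F_meas = sigma_finite_subalgebra.nn_cond_exp_F_meas[OF sigma_finite_subalgebra_F]
  and ce_prod = sigma_finite_subalgebra.nn_cond_exp_prod[OF sigma_finite_subalgebra_F]
  and ce_sum = sigma_finite_subalgebra.nn_cond_exp_sum[OF sigma_finite_subalgebra_F]
  and ce_cong = sigma_finite_subalgebra.nn_cond_exp_cong[OF sigma_finite_subalgebra_F]
  and ce_mono = sigma_finite_subalgebra.nn_cond_exp_mono[OF sigma_finite_subalgebra_F]
  and ce_eq_0_imp = sigma_finite_subalgebra.nn_cond_exp_eq_0_imp[OF sigma_finite_subalgebra_F]
  and ce_Hoelder = sigma_finite_subalgebra.nn_cond_exp_Hoelder[OF sigma_finite_subalgebra_F]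

lemma measurable_F_imp_M: "f \<in> measurable (F n) N \<Longrightarrow> f \<in> measurable M N"
  by (rule measurable_from_subalg[OF subalg])

lemma measurable_F_mono: "k \<le> n \<Longrightarrow> f \<in> measurable (F k) N \<Longrightarrow> f \<in> measurable (F n) N"
  using filtration.sets_F_mono[OF filt] filtration.space_F[OF filt]
  by (intro measurable_from_subalg[of "F n" "F k"]) (auto simp: subalgebra_def)

lemma space_F: "space (F n) = space M"
  using subalg by (simp add: subalgebra_def)

text \<open>Stop at the first index where the quotient exceeds \<open>l\<close>. The event
  \<open>A n\<close> lies in \<open>F n\<close>, so over it \<open>f\<close> and
  \<open>\<nu>\<close> have the same integrals as their conditional expectations, and there
  \<open>l * ce n \<nu>\<close> is at most \<open>ce n f\<close>.\<close>

lemma Doob_weak: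
  fixes f \<nu> :: "'a \<Rightarrow> ennreal"
  assumes [measurable]: "f \<in> borel_measurable M" "\<nu> \<in> borel_measurable M"
  shows "l * (\<integral>\<^sup>+x. \<nu> x * indicator {l<..} (SUP n. ce n f x / ce n \<nu> x) \<partial>M) \<le> (\<integral>\<^sup>+x. f x \<partial>M)"
proof -
  define Y where "Y n x = ce n f x / ce n \<nu> x" for n x
  have YF: "Y n \<in> borel_measurable (F n)" for n unfolding Y_def by measurable
  have YF': "Y k \<in> borel_measurable (F n)" if "k \<le> n" for n k
    using measurable_F_mono[OF that YF] .
  define A where "A n = {x \<in> space M. l < Y n x \<and> (\<forall>k<n. \<not> l < Y k x)}" for n
  have AF [measurable]: "A n \<in> sets (F n)" for n
  proof -
    have less: "{x \<in> space (F n). l < Y k x} \<in> sets (F n)" if "k \<le> n" for k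
      by (rule borel_measurable_less[OF borel_measurable_const YF'[OF that]])
    have "A n = {x \<in> space (F n). l < Y n x} - (\<Union>k<n. {x \<in> space (F n). l < Y k x})"
      by (auto simp: A_def space_F)
    also have "\<dots> \<in> sets (F n)"
      using less by (intro sets.Diff sets.finite_UN) auto
    finally show ?thesis .
  qed
  have [measurable]: "A n \<in> sets M" for n
    using AF[of n] subalg[of n] by (auto simp: subalgebra_def)
  have iA: "(indicator (A n) :: 'a \<Rightarrow> ennreal) \<in> borel_measurable (F n)" for n by measurable
  have disj: "disjoint_family A"
    unfolding disjoint_family_on_def A_def by (auto simp: set_eq_iff) (metis linorder_neqE_nat)
  have UA: "indicator {l<..} (SUP n. Y n x) = (\<Sum>n. indicator (A n) x :: ennreal)" if "x \<in> space M" for x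
  proof -
    have "l < (SUP n. Y n x) \<longleftrightarrow> x \<in> (\<Union>n. A n)"
    proof
      assume "l < (SUP n. Y n x)"
      then obtain n where "l < Y n x" by (auto simp: less_SUP_iff)
      then have "x \<in> A (LEAST n. l < Y n x)"
        using that by (auto simp: A_def intro: LeastI dest: not_less_Least)
      then show "x \<in> (\<Union>n. A n)" by blast
    qed (auto simp: A_def less_SUP_iff)
    then show ?thesis unfolding suminf_indicator[OF disj] by (simp add: indicator_def)
  qed
  have step: "l * (\<integral>\<^sup>+x. indicator (A n) x * \<nu> x \<partial>M) \<le> (\<integral>\<^sup>+x. indicator (A n) x * f x \<partial>M)" for n
  proof -
    have "l * (\<integral>\<^sup>+x. indicator (A n) x * \<nu> x \<partial>M) = l * (\<integral>\<^sup>+x. indicator (A n) x * ce n \<nu> x \<partial>M)"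
      by (simp add: ce_intg[OF iA])
    also have "\<dots> = (\<integral>\<^sup>+x. l * (indicator (A n) x * ce n \<nu> x) \<partial>M)"
      by (rule nn_integral_cmult[symmetric]) measurable
    also have "\<dots> \<le> (\<integral>\<^sup>+x. indicator (A n) x * ce n f x \<partial>M)"
    proof (rule nn_integral_mono)
      fix x
      have "l * ce n \<nu> x \<le> ce n f x" if "l < Y n x"
      proof -
        have "l * ce n \<nu> x \<le> Y n x * ce n \<nu> x" using that by (intro mult_right_mono) auto
        \<comment> \<open>When \<open>ce n \<nu> x\<close> is zero or infinite, the product on the
          left is zero by the conventions for extended values.\<close>
        also have "\<dots> \<le> ce n f x"
          by (cases "ce n \<nu> x = 0 \<or> ce n \<nu> x = top") (auto simp: Y_def ennreal_divide_mult_cancel)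
        finally show ?thesis .
      qed
      then show "l * (indicator (A n) x * ce n \<nu> x) \<le> indicator (A n) x * ce n f x"
        by (auto simp: A_def split: split_indicator)
    qed
    also have "\<dots> = (\<integral>\<^sup>+x. indicator (A n) x * f x \<partial>M)" by (rule ce_intg[OF iA]) simp
    finally show ?thesis .
  qed
  have "l * (\<integral>\<^sup>+x. \<nu> x * indicator {l<..} (SUP n. Y n x) \<partial>M)
      = l * (\<integral>\<^sup>+x. (\<Sum>n. indicator (A n) x * \<nu> x) \<partial>M)"
    by (intro arg_cong2[where f="(*)"] nn_integral_cong) (simp_all add: UA mult.commute)
  also have "\<dots> = (\<Sum>n. l * (\<integral>\<^sup>+x. indicator (A n) x * \<nu> x \<partial>M))"
    by (subst nn_integral_suminf) simp_all
  also have "\<dots> \<le> (\<Sum>n. (\<integral>\<^sup>+x. indicator (A n) x * f x \<partial>M))"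
    by (intro suminf_le step) auto
  also have "\<dots> = (\<integral>\<^sup>+x. (\<Sum>n. indicator (A n) x * f x) \<partial>M)"
    by (rule nn_integral_suminf[symmetric]) simp
  also have "\<dots> = (\<integral>\<^sup>+x. indicator (\<Union>n. A n) x * f x \<partial>M)"
    by (simp add: suminf_indicator[OF disj])
  also have "\<dots> \<le> (\<integral>\<^sup>+x. f x \<partial>M)"
    by (intro nn_integral_mono) (auto split: split_indicator)
  finally show ?thesis by (simp add: Y_def)
qed

text \<open>The part of \<open>f\<close> where \<open>2 * f x \<le> l * \<nu> x\<close> contributes
  at most \<open>l / 2\<close> to each quotient, so exceeding \<open>l\<close> forces the remaining
  part \<open>h\<close> to exceed \<open>l / 2\<close>. The truncation on the right is what permits
  interpolation for every exponent above one.\<close>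

lemma Doob_weak_truncated:
  fixes f \<nu> :: "'a \<Rightarrow> ennreal"
  assumes [measurable]: "f \<in> borel_measurable M" "\<nu> \<in> borel_measurable M" and l: "0 < l"
  shows "ennreal l * (\<integral>\<^sup>+x. \<nu> x * indicator {ennreal l<..} (SUP n. ce n f x / ce n \<nu> x) \<partial>M)
     \<le> 2 * (\<integral>\<^sup>+x. (if ennreal l * \<nu> x < 2 * f x then f x else 0) \<partial>M)"
proof -
  define h where "h x = (if ennreal l * \<nu> x < 2 * f x then f x else 0)" for x
  have [measurable]: "h \<in> borel_measurable M" unfolding h_def by measurable
  have "f x \<le> h x + ennreal (l / 2) * \<nu> x" for x
  proof (cases "2 * f x \<le> ennreal l * \<nu> x")
    case True
    have "ennreal (1 / 2) * 2 = 1" using ennreal_mult[of "1 / 2" 2] by simp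
    then have "f x = ennreal (1 / 2) * (2 * f x)" by (simp add: mult.assoc[symmetric])
    also have "\<dots> \<le> ennreal (1 / 2) * (ennreal l * \<nu> x)" using True by (intro mult_left_mono) auto
    also have "\<dots> = ennreal (l / 2) * \<nu> x" 
      using ennreal_mult[of "1 / 2" l] l by (simp add: mult.assoc[symmetric])
    finally show ?thesis by (simp add: add_increasing)
  qed (auto simp: h_def)
  then have le: "AE x in M. ce n f x \<le> ce n (\<lambda>x. h x + ennreal (l / 2) * \<nu> x) x" for n
    by (intro ce_mono) auto
  have sum: "AE x in M. ce n h x + ce n (\<lambda>x. ennreal (l / 2) * \<nu> x) x
     = ce n (\<lambda>x. h x + ennreal (l / 2) * \<nu> x) x" for n
    by (rule ce_sum) auto
  have prod: "AE x in M. ennreal (l / 2) * ce n \<nu> x = ce n (\<lambda>x. ennreal (l / 2) * \<nu> x) x" for n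
    by (rule ce_prod) auto
  have "AE x in M. ce n f x \<le> ce n h x + ennreal (l / 2) * ce n \<nu> x" for n
    using le[of n] sum[of n] prod[of n] by eventually_elim simp
  then have "AE x in M. \<forall>n. ce n f x \<le> ce n h x + ennreal (l / 2) * ce n \<nu> x"
    by (simp add: AE_all_countable)
  then have "AE x in M. \<nu> x * indicator {ennreal l<..} (SUP n. ce n f x / ce n \<nu> x)
       \<le> \<nu> x * indicator {ennreal (l / 2)<..} (SUP n. ce n h x / ce n \<nu> x)"
  proof eventually_elim
    case (elim x)
    have "ennreal (l / 2) < (SUP n. ce n h x / ce n \<nu> x)" if less: "ennreal l < (SUP n. ce n f x / ce
      n \<nu> x)"
    proof -
      obtain n where n: "ennreal l < ce n f x / ce n \<nu> x" using less by (auto simp: less_SUP_iff)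
      also have "\<dots> \<le> (ce n h x + ennreal (l / 2) * ce n \<nu> x) / ce n \<nu> x"
        using elim by (intro divide_right_mono_ennreal) auto
      also have "\<dots> = ce n h x / ce n \<nu> x + ennreal (l / 2) * (ce n \<nu> x / ce n \<nu> x)"
        by (simp add: divide_ennreal_def distrib_right mult.assoc)
      also have "\<dots> \<le> ce n h x / ce n \<nu> x + ennreal (l / 2) * 1"
        by (intro add_left_mono mult_left_mono) (cases "ce n \<nu> x = 0 \<or> ce n \<nu> x
          = top", auto simp: ennreal_divide_self less_top)
      finally have "ennreal (l / 2) + ennreal (l / 2) < ennreal (l / 2) + ce n h x / ce n \<nu> x"
        using l by (simp add: add.commute flip: ennreal_plus)
      then have "ennreal (l / 2) < ce n h x / ce n \<nu> x"
        by (simp add: ennreal_add_left_cancel_less)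
      then show ?thesis by (auto simp: less_SUP_iff)
    qed
    then show ?case by (auto split: split_indicator)
  qed
  then have "(\<integral>\<^sup>+x. \<nu> x * indicator {ennreal l<..} (SUP n. ce n f x / ce n \<nu> x) \<partial>M)
     \<le> (\<integral>\<^sup>+x. \<nu> x * indicator {ennreal (l / 2)<..} (SUP n. ce n h x / ce n \<nu> x) \<partial>M)"
    by (rule nn_integral_mono_AE)
  moreover have "ennreal l = 2 * ennreal (l / 2)" using ennreal_mult[of 2 "l / 2"] l by simp
  ultimately have "ennreal l * (\<integral>\<^sup>+x. \<nu> x * indicator {ennreal l<..} (SUP n. ce n f x / ce n \<nu> x) \<partial>M)
     \<le> 2 * (ennreal (l / 2) * (\<integral>\<^sup>+x. \<nu> x * indicator {ennreal (l / 2)<..} (SUP n. ce n h x / ce n \<nu> x)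
       \<partial>M))"
    by (simp add: mult.assoc[symmetric] mult_left_mono)
  also have "\<dots> \<le> 2 * (\<integral>\<^sup>+x. h x \<partial>M)"
    by (intro mult_left_mono Doob_weak) auto
  finally show ?thesis by (simp add: h_def)
qed

text \<open>Interpolation of the truncated weak inequality for
  \<open>\<phi> x t = t powr p * \<nu> x\<close>, applied to a multiple of \<open>f / \<nu>\<close>.
  The constant depends on \<open>p\<close> alone and so serves all weights at once.\<close>

lemma weighted_Doob:
  assumes p: "1 < p"
  obtains C where "0 < C"
    "\<And>f \<nu>. \<lbrakk>f \<in> borel_measurable M; \<nu> \<in> borel_measurable M; \<And>x. x \<in> space M \<Longrightarrow> 0 < \<nu> x\<rbrakk> \<Longrightarrow>
      (\<integral>\<^sup>+x. (SUP n. ce n f x / ce n (\<lambda>y. ennreal (\<nu> y)) x) powe p * ennreal (\<nu> x) \<partial>M)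
        \<le> ennreal C * (\<integral>\<^sup>+x. f x powe p * ennreal (\<nu> x powr (1 - p)) \<partial>M)"
proof -
  \<comment> \<open>The constant returned by \<open>dyadic_interpolation\<close> for
    \<open>s1 = 1\<close>, \<open>s2 = p + 1\<close>, both types equal to \<open>p\<close> and the
    other constants equal to one.\<close>
  define B where "B = 1 / (1 - 2 powr (1 - p)) + 1 / (1 - 2 powr (p - (p + 1)))"
  have B: "0 < B" unfolding B_def using p by (intro add_pos_pos) (auto simp: powr_less_one)
  show thesis
  proof
    \<comment> \<open>One factor \<open>2 powr p\<close> comes from the comparison with
      \<open>dyadic_modular\<close>, the other from the factor \<open>2\<close> in
      \<open>g\<close>.\<close>
    show "0 < 2 powr p * (B * 2 powr p)" using B by simp
    fix f :: "'a \<Rightarrow> ennreal" and \<nu> :: "'a \<Rightarrow> real"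
    assume [measurable]: "f \<in> borel_measurable M" "\<nu> \<in> borel_measurable M" and pos: "\<And>x. x \<in> space M \<Longrightarrow>
      0 < \<nu> x"
    define X where "X x = (SUP n. ce n f x / ce n (\<lambda>y. ennreal (\<nu> y)) x)" for x
    \<comment> \<open>With this factor \<open>2\<close>, the condition
      \<open>ennreal t < g x\<close> is exactly the truncation in \<open>Doob_weak_truncated\<close>
      at level \<open>t\<close>.\<close>
    define g where "g x = 2 * f x / ennreal (\<nu> x)" for x
    define \<phi> where "\<phi> x t = t powr p * \<nu> x" for x t
    have [measurable]: "X \<in> borel_measurable M" "g \<in> borel_measurable M"
      unfolding X_def g_def by measurable
    have MO: "MO_ext \<phi> x t = t powe p * ennreal (\<nu> x)" if "x \<in> space M" for x t
      using pos[OF that] by (cases t) (auto simp: MO_ext_def \<phi>_def ennreal_powe ennreal_mult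
        ennreal_top_mult)
    have gp: "g x powe p * ennreal (\<nu> x) = ennreal (2 powr p) * (f x powe p *
      ennreal (\<nu> x powr (1 - p)))"
      if "x \<in> space M" for x
    proof -
      note n = pos[OF that]
      have "\<nu> x powr (1 - p) = \<nu> x / \<nu> x powr p" using n by (simp add: powr_diff)
      then have "ennreal (\<nu> x powr (1 - p)) = ennreal (\<nu> x) / ennreal (\<nu> x) powe p"
        using n by (simp add: ennreal_powe divide_ennreal)
      moreover have "(2::ennreal) powe p = ennreal (2 powr p)" using ennreal_powe[of 2 p] by simp
      ultimately show ?thesis
        using n by (simp add: g_def powe_divide powe_mult) (simp add: divide_ennreal_def mult_ac)
    qed
    show "(\<integral>\<^sup>+x. (SUP n. ce n f x / ce n (\<lambda>y. ennreal (\<nu> y)) x) powe p * ennreal (\<nu> x) \<partial>M)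
        \<le> ennreal (2 powr p * (B * 2 powr p)) * (\<integral>\<^sup>+x. f x powe p * ennreal (\<nu> x powr (1 - p)) \<partial>M)"
    \<comment> \<open>Interpolation requires \<open>g\<close> to be finite almost everywhere.
      Otherwise the right-hand side is infinite, because the weight is positive.\<close>
    proof (cases "AE x in M. g x \<noteq> top")
      case True
      have "(\<integral>\<^sup>+x. X x powe p * ennreal (\<nu> x) \<partial>M) = (\<integral>\<^sup>+x. MO_ext \<phi> x (X x) \<partial>M)"
        by (intro nn_integral_cong) (simp add: MO)
      also have "\<dots> \<le> ennreal (2 powr p) * (\<integral>\<^sup>+x. dyadic_modular \<phi> x (X x) \<partial>M)"
      proof (rule nn_integral_le_cmult)
        have "(\<lambda>x. X x powe p * ennreal (\<nu> x)) \<in> borel_measurable M" by measurable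
        then show "(\<lambda>x. MO_ext \<phi> x (X x)) \<in> borel_measurable M"
          by (subst measurable_cong[where g="\<lambda>x. X x powe p * ennreal (\<nu> x)"]) (auto simp: MO)
        show "AE x in M. MO_ext \<phi> x (X x) \<le> ennreal (2 powr p) * dyadic_modular \<phi> x (X x)"
        proof (rule AE_I2)
          fix x assume "x \<in> space M"
          note n = pos[OF this]
          show "MO_ext \<phi> x (X x) \<le> ennreal (2 powr p) * dyadic_modular \<phi> x (X x)"
            using n p by (intro MO_ext_le_dyadic_modular[where c=1, simplified] mono_onI)
              (auto simp: \<phi>_def powr_mult intro!: mult_right_mono powr_mono2)
        qed
      qed simp
      also have "(\<integral>\<^sup>+x. dyadic_modular \<phi> x (X x) \<partial>M)
        \<le> ennreal (1 * (1 / (1 - 2 powr (1 - p)) + 1 / (1 - 2 powr (p - (p + 1))))) *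
              (\<integral>\<^sup>+x. MO_ext \<phi> x (g x) \<partial>M)"
      proof (rule dyadic_interpolation)
        fix j :: int
        let ?t = "2 powr j"
        have "(\<integral>\<^sup>+x. ennreal (\<phi> x ?t) * indicator {ennreal ?t<..} (X x) \<partial>M)
           = (\<integral>\<^sup>+x. ennreal (?t powr p) * (ennreal (\<nu> x) * indicator {ennreal ?t<..} (X x)) \<partial>M)"
          using pos by (intro nn_integral_cong) (simp add: \<phi>_def ennreal_mult less_imp_le mult.assoc)
        also have "\<dots> = ennreal (?t powr p) * (\<integral>\<^sup>+x. ennreal (\<nu> x) * indicator {ennreal ?t<..} (X x) \<partial>M)"
          by (rule nn_integral_cmult) measurable
        also have "\<dots> = ennreal (?t powr p) * (ennreal (1 / ?t) * (ennreal ?t * (\<integral>\<^sup>+x. ennreal (\<nu> x) *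
          indicator {ennreal ?t<..} (X x) \<partial>M)))"
        proof -
          have "ennreal (1 / ?t) * ennreal ?t = 1" by (subst ennreal_mult[symmetric]) auto
          then show ?thesis by (simp add: mult.assoc[symmetric])
        qed
        also have "\<dots> \<le> ennreal (?t powr p) * (ennreal (1 / ?t) * (2 * (\<integral>\<^sup>+x. (if ennreal ?t *
          ennreal (\<nu> x) < 2 * f x then f x else 0) \<partial>M)))"
          unfolding X_def by (intro mult_left_mono Doob_weak_truncated) auto
        also have "\<dots> = (\<integral>\<^sup>+x. ennreal (?t powr p) * (ennreal (1 / ?t) * (2 * (if ennreal ?t *
          ennreal (\<nu> x) < 2 * f x then f x else 0))) \<partial>M)"
          by (simp add: nn_integral_cmult)
        also have "\<dots> = (\<integral>\<^sup>+x. ennreal (2 powr (- (1::real) * j)) * (g x powe 1 *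
          indicator {ennreal ?t<..} (g x) * ennreal (\<phi> x ?t)) \<partial>M)"
        proof (intro nn_integral_cong)
          fix x assume x: "x \<in> space M"
          note n = pos[OF x]
          have g: "g x * ennreal (\<nu> x) = 2 * f x"
            using n by (simp add: g_def ennreal_divide_mult_cancel)
          moreover have "ennreal ?t < g x \<longleftrightarrow> ennreal ?t * ennreal (\<nu> x) < 2 * f x"
            unfolding g[symmetric] not_le[symmetric]
            using n ennreal_mult_le_mult_iff[of "ennreal (\<nu> x)" "g x" "ennreal ?t"]
            by (simp add: mult.commute[of _ "ennreal (\<nu> x)"])
          moreover have "ennreal (\<phi> x ?t) = ennreal (?t powr p) * ennreal (\<nu> x)"
            using n by (simp add: \<phi>_def ennreal_mult)
          moreover have "ennreal (2 powr (- (1::real) * j)) * (g x powe 1 *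
            indicator {ennreal ?t<..} (g x) * ennreal (\<phi> x ?t))
            = ennreal (?t powr p) * (ennreal (1 / ?t) * ((g x * ennreal (\<nu> x)) *
              indicator {ennreal ?t<..} (g x)))"
            using calculation(3) by (simp add: powr_minus_divide mult_ac)
          ultimately show "ennreal (?t powr p) * (ennreal (1 / ?t) * (2 * (if ennreal ?t *
            ennreal (\<nu> x) < 2 * f x then f x else 0)))
            = ennreal (2 powr (- (1::real) * j)) * (g x powe 1 * indicator {ennreal ?t<..} (g x) *
              ennreal (\<phi> x ?t))"
            by (simp split: split_indicator)
        qed
        also have "\<dots> = ennreal (2 powr (- (1::real) * j)) * (\<integral>\<^sup>+x. g x powe 1 *
          indicator {ennreal ?t<..} (g x) * ennreal (\<phi> x ?t) \<partial>M)"
          unfolding \<phi>_def by (rule nn_integral_cmult) measurable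
        finally show "(\<integral>\<^sup>+x. ennreal (\<phi> x ?t) * indicator {ennreal ?t<..} (X x) \<partial>M)
          \<le> ennreal 1 * (ennreal (2 powr (- (1::real) * j)) * (\<integral>\<^sup>+x. g x powe 1 *
            indicator {ennreal ?t<..} (g x) * ennreal (\<phi> x ?t) \<partial>M)
           + ennreal (2 powr (- (p + 1) * j)) *
            (\<integral>\<^sup>+x. g x powe (p + 1) * indicator {..ennreal ?t} (g x) * ennreal (\<phi> x ?t) \<partial>M))"
          by (simp add: add_increasing2)
      qed (use True p pos in \<open>auto simp: \<phi>_def powr_mult less_imp_le\<close>)
      also have "(\<integral>\<^sup>+x. MO_ext \<phi> x (g x) \<partial>M) = ennreal (2 powr p) * (\<integral>\<^sup>+x. f x powe p *
        ennreal (\<nu> x powr (1 - p)) \<partial>M)"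
        by (subst nn_integral_cmult[symmetric]) (auto intro!: nn_integral_cong simp: MO gp)
      finally show ?thesis
        using B unfolding X_def[symmetric] B_def[symmetric]
        by (simp add: ennreal_mult mult.assoc mult_left_mono)
    next
      case False
      have "(\<integral>\<^sup>+x. g x powe p * ennreal (\<nu> x) \<partial>M) = top"
      proof (rule ccontr)
        assume "(\<integral>\<^sup>+x. g x powe p * ennreal (\<nu> x) \<partial>M) \<noteq> top"
        then have "AE x in M. g x powe p * ennreal (\<nu> x) \<noteq> \<infinity>"
          by (intro nn_integral_noteq_infinite) auto
        then have "AE x in M. g x \<noteq> top"
          using AE_space
        proof eventually_elim
          case (elim x)
          then show ?case using pos[of x] by (auto simp: ennreal_top_mult)
        qed
        then show False using False by blast
      qed
      also have "(\<integral>\<^sup>+x. g x powe p * ennreal (\<nu> x) \<partial>M)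
        = ennreal (2 powr p) * (\<integral>\<^sup>+x. f x powe p * ennreal (\<nu> x powr (1 - p)) \<partial>M)"
        by (subst nn_integral_cmult[symmetric]) (auto intro!: nn_integral_cong simp: gp)
      finally have "(\<integral>\<^sup>+x. f x powe p * ennreal (\<nu> x powr (1 - p)) \<partial>M) = top"
        by (simp add: ennreal_mult_eq_top_iff)
      then show ?thesis using B by (simp add: ennreal_mult_top)
    qed
  qed
qed

subsection \<open>Muckenhoupt weights\<close>

text \<open>Unlike \<open>MO_A\<close>, this concerns a single weight and displays its constant. The
  estimates below depend on the weight only through \<open>s\<close> and \<open>K\<close>, and thus
  hold uniformly over the weights \<open>\<lambda>x. \<phi> x t\<close>.\<close>

definition A_weight :: "real \<Rightarrow> real \<Rightarrow> ('a \<Rightarrow> real) \<Rightarrow> bool" where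
  "A_weight s K w \<longleftrightarrow> w \<in> borel_measurable M \<and> (\<forall>x\<in>space M. 0 < w x) \<and>
     (\<forall>n. AE x in M. ce n (\<lambda>y. ennreal (w y)) x *
        ce n (\<lambda>y. ennreal (w y powr (- 1 / (s - 1)))) x powe (s - 1) \<le> ennreal K)"

lemma A_weightD:
  assumes "A_weight s K w"
  shows "w \<in> borel_measurable M" "x \<in> space M \<Longrightarrow> 0 < w x"
    "AE x in M. ce n (\<lambda>y. ennreal (w y)) x *
        ce n (\<lambda>y. ennreal (w y powr (- 1 / (s - 1)))) x powe (s - 1) \<le> ennreal K"
  using assms by (auto simp: A_weight_def)

lemma ce_positive:
  assumes [measurable]: "w \<in> borel_measurable M" and "\<And>x. x \<in> space M \<Longrightarrow> 0 < w x"
  shows "AE x in M. ce n (\<lambda>y. ennreal (w y)) x \<noteq> 0"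
proof -
  have "AE x in M. ce n (\<lambda>y. ennreal (w y)) x = 0 \<longrightarrow> ennreal (w x) = 0"
    by (rule ce_eq_0_imp) measurable
  then show ?thesis using AE_space by eventually_elim (use assms(2) in fastforce)
qed

text \<open>Both factors are positive almost everywhere, so a finite bound on the product makes both
  finite. This justifies the later divisions by conditional expectations of weights.\<close>

lemma A_weight_bounds:
  assumes w: "A_weight s K w"
  defines "\<sigma> \<equiv> \<lambda>y. w y powr (- 1 / (s - 1))"
  shows "AE x in M. ce n (\<lambda>y. ennreal (w y)) x \<noteq> 0 \<and> ce n (\<lambda>y. ennreal (w y)) x \<noteq> top \<and>
     ce n (\<lambda>y. ennreal (\<sigma> y)) x \<noteq> 0 \<and> ce n (\<lambda>y. ennreal (\<sigma> y)) x \<noteq> top \<and>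
     ce n (\<lambda>y. ennreal (w y)) x * ce n (\<lambda>y. ennreal (\<sigma> y)) x powe (s - 1) \<le> ennreal K"
proof -
  note [measurable] = A_weightD(1)[OF w]
  have "AE x in M. ce n (\<lambda>y. ennreal (w y)) x \<noteq> 0"
    by (rule ce_positive) (use A_weightD(2)[OF w] in auto)
  moreover have "AE x in M. ce n (\<lambda>y. ennreal (\<sigma> y)) x \<noteq> 0"
    unfolding \<sigma>_def by (rule ce_positive) (use A_weightD(2)[OF w] in force)+
  ultimately show ?thesis
    using A_weightD(3)[OF w, of n] unfolding \<sigma>_def
    by eventually_elim (auto simp: ennreal_mult_top ennreal_top_mult top_unique)
qed

text \<open>Since \<open>s / (s - 1) - 1 = 1 / (s - 1)\<close>, the dual weight of the dual weight
  is \<open>w\<close> again, and the new condition is the old one raised to the power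
  \<open>1 / (s - 1)\<close>.\<close>

lemma A_weight_dual:
  assumes s: "1 < s" and K: "0 < K" and w: "A_weight s K w"
  shows "A_weight (s / (s - 1)) (K powr (1 / (s - 1))) (\<lambda>x. w x powr (- 1 / (s - 1)))"
  unfolding A_weight_def
proof (intro conjI ballI allI)
  note [measurable] = A_weightD(1)[OF w]
  show "(\<lambda>x. w x powr (- 1 / (s - 1))) \<in> borel_measurable M" by measurable
  fix x assume "x \<in> space M"
  then show "0 < w x powr (- 1 / (s - 1))" using A_weightD(2)[OF w, of x] by simp
next
  fix n
  note [measurable] = A_weightD(1)[OF w]
  have e: "s / (s - 1) - 1 = 1 / (s - 1)" using s by (simp add: field_simps)
  have neg: "(1 - s) / (s - 1) = - 1" using s by (simp add: divide_eq_eq)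
  have "AE x in M. ce n (\<lambda>y. ennreal ((w y powr (- 1 / (s - 1))) powr (- 1 / (s / (s - 1) - 1)))) x
      = ce n (\<lambda>y. ennreal (w y)) x"
  proof (rule ce_cong)
    show "AE x in M. ennreal ((w x powr (- 1 / (s - 1))) powr (- 1 / (s / (s - 1) - 1)))
      = ennreal (w x)"
    proof (rule AE_I2)
      fix x assume "x \<in> space M"
      then have "0 < w x" by (rule A_weightD(2)[OF w])
      then show "ennreal ((w x powr (- 1 / (s - 1))) powr (- 1 / (s / (s - 1) - 1))) = ennreal (w x)"
        using s neg by (simp add: e powr_powr)
    qed
  qed measurable
  then show "AE x in M. ce n (\<lambda>y. ennreal (w y powr (- 1 / (s - 1)))) x *
     ce n (\<lambda>y. ennreal ((w y powr (- 1 / (s - 1))) powr (- 1 / (s / (s - 1) - 1)))) x powe (s / (s -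
       1) - 1)
       \<le> ennreal (K powr (1 / (s - 1)))"
    using A_weightD(3)[OF w, of n]
  proof eventually_elim
    case (elim x)
    let ?W = "ce n (\<lambda>y. ennreal (w y)) x" and ?S = "ce n (\<lambda>y. ennreal (w y powr (- 1 / (s - 1)))) x"
    have "(?W * ?S powe (s - 1)) powe (1 / (s - 1)) \<le> ennreal K powe (1 / (s - 1))"
      using elim(2) s by (intro powe_mono) auto
    then show ?case
      unfolding elim(1) using s K by (simp add: e powe_mult powe_powe ennreal_powe mult.commute)
  qed
qed

text \<open>With \<open>Y\<^sub>n = E\<^sub>n f / E\<^sub>n \<sigma>\<close> and \<open>G = sup Y\<^sub>n\<close>, the \<open>A\<^sub>s\<close> condition gives
  \<open>(E\<^sub>n f)\<^bsup>s-1\<^esup> \<le> K E\<^sub>n(G\<^bsup>s-1\<^esup>) / E\<^sub>n w\<close>, so two weighted Doob inequalities, for \<open>w\<close> and for \<open>\<sigma>\<close>,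
    suffice.\<close>

lemma maximal_A_weight:
  assumes s: "1 < s" and K: "0 < K"
  obtains C where "0 < C"
    "\<And>f w. \<lbrakk>f \<in> borel_measurable M; A_weight s K w\<rbrakk> \<Longrightarrow>
      (\<integral>\<^sup>+x. (SUP n. ce n f x) powe s * ennreal (w x) \<partial>M)
        \<le> ennreal C * (\<integral>\<^sup>+x. f x powe s * ennreal (w x) \<partial>M)"
proof -
  define s' where "s' = s / (s - 1)"
  have s': "1 < s'" "(s - 1) * s' = s" "1 - s' = - 1 / (s - 1)" using s
    by (auto simp: s'_def field_simps)
  obtain C1 where C1: "0 < C1"
    "\<And>f \<nu>. \<lbrakk>f \<in> borel_measurable M; \<nu> \<in> borel_measurable M; \<And>x. x \<in> space M \<Longrightarrow> 0 < \<nu> x\<rbrakk> \<Longrightarrow>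
      (\<integral>\<^sup>+x. (SUP n. ce n f x / ce n (\<lambda>y. ennreal (\<nu> y)) x) powe s * ennreal (\<nu> x) \<partial>M)
        \<le> ennreal C1 * (\<integral>\<^sup>+x. f x powe s * ennreal (\<nu> x powr (1 - s)) \<partial>M)"
    using weighted_Doob[OF s] by blast
  obtain C2 where C2: "0 < C2"
    "\<And>f \<nu>. \<lbrakk>f \<in> borel_measurable M; \<nu> \<in> borel_measurable M; \<And>x. x \<in> space M \<Longrightarrow> 0 < \<nu> x\<rbrakk> \<Longrightarrow>
      (\<integral>\<^sup>+x. (SUP n. ce n f x / ce n (\<lambda>y. ennreal (\<nu> y)) x) powe s' * ennreal (\<nu> x) \<partial>M)
        \<le> ennreal C2 * (\<integral>\<^sup>+x. f x powe s' * ennreal (\<nu> x powr (1 - s')) \<partial>M)"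
    using weighted_Doob[OF s'(1)] by blast
  show thesis
  proof
    \<comment> \<open>\<open>K powr s'\<close> comes from raising \<open>K * D\<close> to the power
      \<open>s / (s - 1)\<close>; \<open>C2\<close> is the Doob constant for \<open>w\<close> at
      exponent \<open>s'\<close>, and \<open>C1\<close> the one for \<open>\<sigma>\<close> at
      exponent \<open>s\<close>.\<close>
    show "0 < K powr s' * (C2 * C1)" using K C1 C2 by simp
    fix f :: "'a \<Rightarrow> ennreal" and w :: "'a \<Rightarrow> real"
    assume [measurable]: "f \<in> borel_measurable M" and w: "A_weight s K w"
    note [measurable] = A_weightD(1)[OF w]
    define \<sigma> where "\<sigma> y = w y powr (- 1 / (s - 1))" for y
    have \<sigma>: "0 < \<sigma> x" "\<sigma> x powr (1 - s) = w x" if "x \<in> space M" for x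
      using A_weightD(2)[OF w that] s divide_eq_eq[of "1 - s" "s - 1" "- 1"]
        by (simp_all add: \<sigma>_def powr_powr)
    have [measurable]: "\<sigma> \<in> borel_measurable M" unfolding \<sigma>_def by measurable
    define W where "W n = ce n (\<lambda>y. ennreal (w y))" for n
    define V where "V n = ce n (\<lambda>y. ennreal (\<sigma> y))" for n
    define Y where "Y n x = ce n f x / V n x" for n x
    define G where "G x = (SUP n. Y n x)" for x
    define D where "D x = (SUP n. ce n (\<lambda>y. G y powe (s - 1)) x / W n x)" for x
    have [measurable]: "W n \<in> borel_measurable M" "V n \<in> borel_measurable M" for n
      by (auto simp: W_def V_def)
    have [measurable]: "Y n \<in> borel_measurable M" for n unfolding Y_def by measurable
    have YF: "(\<lambda>x. Y n x powe (s - 1)) \<in> borel_measurable (F n)" for n unfolding Y_def V_def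
      by measurable
    have [measurable]: "G \<in> borel_measurable M" unfolding G_def by measurable
    have [measurable]: "D \<in> borel_measurable M" unfolding D_def by measurable
    have "AE x in M. ce n f x powe (s - 1) \<le> ennreal K * D x" for n
    proof -
      \<comment> \<open>The power of \<open>Y n\<close> is measurable for \<open>F n\<close>, so it
        equals its own conditional expectation, which is dominated by that of the power of
        \<open>G\<close>.\<close>
      have "AE x in M. ce n (\<lambda>x. Y n x powe (s - 1)) x \<le> ce n (\<lambda>y. G y powe (s - 1)) x"
        using s by (intro ce_mono AE_I2 powe_mono) (auto simp: G_def intro: SUP_upper)
      with ce_F_meas[OF YF[of n]] A_weight_bounds[OF w, of n] show ?thesis
        unfolding \<sigma>_def[symmetric] W_def[symmetric] V_def[symmetric]
      proof eventually_elim
        case (elim x)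
        have "ce n f x = Y n x * V n x" using elim by (simp add: Y_def ennreal_divide_mult_cancel)
        then have "ce n f x powe (s - 1) = Y n x powe (s - 1) * V n x powe (s - 1)"
          by (simp add: powe_mult)
        also have "\<dots> = (Y n x powe (s - 1) / W n x) * (W n x * V n x powe (s - 1))"
          using elim by (simp add: mult.assoc[symmetric] ennreal_divide_mult_cancel)
        also have "\<dots> \<le> (ce n (\<lambda>y. G y powe (s - 1)) x / W n x) * ennreal K"
          using elim by (intro mult_mono divide_right_mono_ennreal) auto
        also have "\<dots> \<le> D x * ennreal K"
          by (intro mult_right_mono) (auto simp: D_def intro: SUP_upper)
        finally show ?case by (simp add: mult.commute)
      qed
    qed
    then have "AE x in M. \<forall>n. ce n f x powe (s - 1) \<le> ennreal K * D x"
      by (simp add: AE_all_countable)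
    then have "AE x in M. (SUP n. ce n f x) powe s * ennreal (w x)
      \<le> ennreal (K powr s') * (D x powe s' * ennreal (w x))"
    proof eventually_elim
      case (elim x)
      have "(SUP n. ce n f x) \<le> (ennreal K * D x) powe (1 / (s - 1))"
        using elim s by (intro SUP_least) (simp add: powe_le_swap)
      then have "(SUP n. ce n f x) powe s \<le> ((ennreal K * D x) powe (1 / (s - 1))) powe s"
        using s by (intro powe_mono) auto
      also have "\<dots> = ennreal (K powr s') * D x powe s'"
        using K by (simp add: powe_powe powe_mult ennreal_powe powr_powr s'_def)
      finally show ?case by (simp add: mult.assoc[symmetric] mult_right_mono)
    qed
    then have "(\<integral>\<^sup>+x. (SUP n. ce n f x) powe s * ennreal (w x) \<partial>M)
       \<le> (\<integral>\<^sup>+x. ennreal (K powr s') * (D x powe s' * ennreal (w x)) \<partial>M)"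
      by (rule nn_integral_mono_AE)
    also have "\<dots> = ennreal (K powr s') * (\<integral>\<^sup>+x. D x powe s' * ennreal (w x) \<partial>M)"
      by (rule nn_integral_cmult) measurable
    also have "(\<integral>\<^sup>+x. D x powe s' * ennreal (w x) \<partial>M)
       \<le> ennreal C2 * (\<integral>\<^sup>+x. (G x powe (s - 1)) powe s' * ennreal (w x powr (1 - s')) \<partial>M)"
      unfolding D_def W_def by (rule C2(2)) (use A_weightD(2)[OF w] in auto)
    \<comment> \<open>The exponents are conjugate: \<open>(s - 1) * s' = s\<close> and
      \<open>w powr (1 - s') = \<sigma>\<close> produce an integral against \<open>\<sigma>\<close>.
      Doob's inequality for \<open>\<sigma>\<close> then leads back to \<open>w\<close>, because
      \<open>\<sigma> powr (1 - s) = w\<close>.\<close>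
    also have "\<dots> = ennreal C2 * (\<integral>\<^sup>+x. G x powe s * ennreal (\<sigma> x) \<partial>M)"
      unfolding powe_powe s'(2) s'(3) \<sigma>_def ..
    also have "(\<integral>\<^sup>+x. G x powe s * ennreal (\<sigma> x) \<partial>M)
      \<le> ennreal C1 * (\<integral>\<^sup>+x. f x powe s * ennreal (\<sigma> x powr (1 - s)) \<partial>M)"
      unfolding G_def Y_def V_def by (rule C1(2)) (use \<sigma>(1) in auto)
    also have "(\<integral>\<^sup>+x. f x powe s * ennreal (\<sigma> x powr (1 - s)) \<partial>M)
      = (\<integral>\<^sup>+x. f x powe s * ennreal (w x) \<partial>M)"
      by (intro nn_integral_cong) (simp add: \<sigma>(2))
    finally show "(\<integral>\<^sup>+x. (SUP n. ce n f x) powe s * ennreal (w x) \<partial>M)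
        \<le> ennreal (K powr s' * (C2 * C1)) * (\<integral>\<^sup>+x. f x powe s * ennreal (w x) \<partial>M)"
      using K C1(1) C2(1) by (simp add: ennreal_mult mult.assoc mult_left_mono)
  qed
qed

section \<open>Vector-valued inequalities for a single Muckenhoupt weight\<close>

lemma ce_Hoelder3:
  assumes abc: "0 < a" "0 < b" "0 < c" "a + b + c = 1"
    and [measurable]: "f \<in> borel_measurable M" "g \<in> borel_measurable M" "h \<in> borel_measurable M"
  shows "AE x in M. ce n (\<lambda>x. f x powe a * (g x powe b * h x powe c)) x
            \<le> ce n f x powe a * (ce n g x powe b * ce n h x powe c)"
proof -
  define e where "e = 1 - a"
  have e: "0 < e" "a + e = 1" "b / e + c / e = 1" using abc
    by (auto simp: e_def add_divide_distrib[symmetric])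
  let ?k = "\<lambda>x. g x powe (b / e) * h x powe (c / e)"
  have k: "?k x powe e = g x powe b * h x powe c" for x using e by (simp add: powe_mult powe_powe)
  have "AE x in M. ce n (\<lambda>x. f x powe a * ?k x powe e) x \<le> ce n f x powe a * ce n ?k x powe e"
    using abc e by (intro ce_Hoelder) auto
  moreover have "AE x in M. ce n ?k x \<le> ce n g x powe (b / e) * ce n h x powe (c / e)"
    using abc e by (intro ce_Hoelder) auto
  ultimately show ?thesis
  proof eventually_elim
    case (elim x)
    have "ce n ?k x powe e \<le> (ce n g x powe (b / e) * ce n h x powe (c / e)) powe e"
      using elim(2) e by (intro powe_mono) auto
    also have "\<dots> = ce n g x powe b * ce n h x powe c" using e by (simp add: powe_mult powe_powe)
    finally show ?case using elim(1) unfolding k by (meson mult_left_mono order_trans zero_le)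
  qed
qed

text \<open>Hoelder with exponents \<open>s / r\<close> and \<open>1 - s / r\<close> separates the
  sum \<open>B\<close> of the quotients \<open>b k\<close> from the maximal function
  \<open>H\<close>. The integral of \<open>B * w\<close> is at most \<open>Q\<close>, because the
  \<open>u k\<close> sum to at most \<open>f powe s\<close>, and \<open>maximal_A_weight\<close>
  controls \<open>H\<close>.\<close>

lemma vector_strong_below:
  assumes s: "1 < s" "s < r" and K: "0 < K"
  obtains C where "0 < C"
    "\<And>w g. \<lbrakk>A_weight s K w; \<And>k. g k \<in> borel_measurable M; AE x in M. (\<Sum>k. g k x powe r) \<noteq> top\<rbrakk> \<Longrightarrow>
      (\<integral>\<^sup>+x. (\<Sum>k. ce k (g k) x powe r) powe (s / r) * ennreal (w x) \<partial>M)
        \<le> ennreal C * (\<integral>\<^sup>+x. (\<Sum>k. g k x powe r) powe (s / r) * ennreal (w x) \<partial>M)"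
proof -
  obtain C where C: "0 < C"
    "\<And>f w. \<lbrakk>f \<in> borel_measurable M; A_weight s K w\<rbrakk> \<Longrightarrow>
      (\<integral>\<^sup>+x. (SUP n. ce n f x) powe s * ennreal (w x) \<partial>M)
        \<le> ennreal C * (\<integral>\<^sup>+x. f x powe s * ennreal (w x) \<partial>M)"
    using maximal_A_weight[OF s(1) K] by blast
  show thesis
  proof
    \<comment> \<open>\<open>K\<close> enters through the power \<open>s / r\<close> of the
      pointwise bound for \<open>S\<close>, and \<open>C\<close> through the second factor in
      Hoelder's inequality.\<close>
    show "0 < K powr (s / r) * C powr (1 - s / r)" using C K by simp
    fix w :: "'a \<Rightarrow> real" and g :: "nat \<Rightarrow> 'a \<Rightarrow> ennreal"
    assume w: "A_weight s K w" and [measurable]: "\<And>k. g k \<in> borel_measurable M"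
      and fin: "AE x in M. (\<Sum>k. g k x powe r) \<noteq> top"
    note [measurable] = A_weightD(1)[OF w]
    note wpos = A_weightD(2)[OF w]
    define \<sigma> where "\<sigma> y = w y powr (- 1 / (s - 1))" for y
    define P where "P x = (\<Sum>k. g k x powe r)" for x
    define f where "f x = P x powe (1 / r)" for x
    define H where "H x = (SUP n. ce n f x)" for x
    \<comment> \<open>Where \<open>f\<close> is positive and finite, these functions share out
      \<open>f powe s\<close> among the indices in proportion to
      \<open>g k x powe r\<close>.\<close>
    define u where "u k x = g k x powe r / f x powe (r - s)" for k x
    define W where "W n = ce n (\<lambda>y. ennreal (w y))" for n
    define V where "V n = ce n (\<lambda>y. ennreal (\<sigma> y))" for n
    define b where "b k x = ce k (\<lambda>y. u k y * ennreal (w y)) x / W k x" for k x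
    define S where "S x = (\<Sum>k. ce k (g k) x powe r)" for x
    define Q where "Q = (\<integral>\<^sup>+x. P x powe (s / r) * ennreal (w x) \<partial>M)"
    have [measurable]: "\<sigma> \<in> borel_measurable M" "P \<in> borel_measurable M" unfolding \<sigma>_def P_def
      by measurable
    have [measurable]: "f \<in> borel_measurable M" unfolding f_def by measurable
    have [measurable]: "H \<in> borel_measurable M" "\<And>k. u k \<in> borel_measurable M" unfolding H_def u_def
      by measurable
    have bF: "b k \<in> borel_measurable (F k)" for k unfolding b_def W_def by measurable
    have [measurable]: "b k \<in> borel_measurable M" for k using bF by (rule measurable_F_imp_M)
    have [measurable]: "S \<in> borel_measurable M" unfolding S_def by measurable
    have r: "0 < r" using s by simp
    have fr: "f x powe r = P x" "f x powe s = P x powe (s / r)" for x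
      using r by (simp_all add: f_def powe_powe)
    have finf: "AE x in M. f x \<noteq> top" using fin by (simp add: f_def P_def)
    \<comment> \<open>The exponents \<open>1 / r\<close>, \<open>(r - s) / r\<close> and
      \<open>(s - 1) / r\<close> add up to one, as \<open>ce_Hoelder3\<close> requires, and the
      powers of \<open>w\<close> and \<open>\<sigma>\<close> cancel.\<close>
    have gk: "AE x in M. g k x \<le> (u k x * ennreal (w x)) powe (1 / r) *
          (f x powe ((r - s) / r) * ennreal (\<sigma> x) powe ((s - 1) / r))" for k
      using finf AE_space
    proof eventually_elim
      case (elim x)
      have w1: "ennreal (w x) powe (1 / r) * ennreal (\<sigma> x) powe ((s - 1) / r) = 1"
        using wpos[OF elim(2)] r s by (simp add: \<sigma>_def ennreal_powe powr_powr weight_mult)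
      have "g k x powe r \<le> P x" unfolding P_def
        using sum_le_suminf[of "\<lambda>k. g k x powe r" "{k}"] by simp
      show ?case
      proof (cases "f x = 0")
        case True
        then have "g k x = 0" using \<open>g k x powe r \<le> P x\<close> fr(1)[of x] by simp
        then show ?thesis by simp
      next
        case False
        have "g k x = (u k x * f x powe (r - s)) powe (1 / r)"
          using False elim r by (simp add: u_def ennreal_divide_mult_cancel)
        also have "\<dots> = u k x powe (1 / r) * f x powe ((r - s) / r) *
            (ennreal (w x) powe (1 / r) * ennreal (\<sigma> x) powe ((s - 1) / r))"
          unfolding w1 by (simp add: powe_mult powe_powe)
        also have "\<dots> = (u k x * ennreal (w x)) powe (1 / r) *
          (f x powe ((r - s) / r) * ennreal (\<sigma> x) powe ((s - 1) / r))"
          by (simp add: powe_mult mult_ac)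
        finally show ?thesis by simp
      qed
    qed
    have ak: "AE x in M. ce k (g k) x powe r \<le> ennreal K * (b k x * H x powe (r - s))" for k
    proof -
      have "AE x in M. ce k (g k) x \<le> ce k (\<lambda>x. (u k x * ennreal (w x)) powe (1 / r) *
          (f x powe ((r - s) / r) * ennreal (\<sigma> x) powe ((s - 1) / r))) x"
        using gk by (rule ce_mono) measurable
      moreover have "AE x in M. ce k (\<lambda>x. (u k x * ennreal (w x)) powe (1 / r) *
          (f x powe ((r - s) / r) * ennreal (\<sigma> x) powe ((s - 1) / r))) x
        \<le> ce k (\<lambda>x. u k x * ennreal (w x)) x powe (1 / r) * (ce k f x powe ((r - s) / r) *
          V k x powe ((s - 1) / r))"
        unfolding V_def using s r by (intro ce_Hoelder3) (auto simp: field_simps)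
      ultimately show ?thesis
        using A_weight_bounds[OF w, of k] unfolding \<sigma>_def[symmetric] W_def[symmetric] V_def[symmetric]
      proof eventually_elim
        case (elim x)
        let ?U = "ce k (\<lambda>x. u k x * ennreal (w x)) x"
        have "ce k (g k) x \<le> ?U powe (1 / r) * (ce k f x powe ((r - s) / r) * V k x powe ((s - 1) / r))"
          using elim(1,2) by (rule order_trans)
        then have "ce k (g k) x powe r \<le> (?U powe (1 / r) * (ce k f x powe ((r - s) / r) *
          V k x powe ((s - 1) / r))) powe r"
          using r by (intro powe_mono) auto
        also have "\<dots> = ?U * (ce k f x powe (r - s) * V k x powe (s - 1))"
          using r by (simp add: powe_mult powe_powe)
        \<comment> \<open>Writing the first factor as \<open>b k x * W k x\<close> completes the
          product \<open>W k x * V k x powe (s - 1)\<close>, which is bounded by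
          \<open>K\<close>.\<close>
        also have "\<dots> = b k x * (ce k f x powe (r - s) * (W k x * V k x powe (s - 1)))"
        proof -
          have "?U = b k x * W k x" using elim(3) by (simp add: b_def ennreal_divide_mult_cancel)
          then show ?thesis by (simp add: mult_ac)
        qed
        also have "\<dots> \<le> b k x * (H x powe (r - s) * ennreal K)"
          using elim(3) s by (intro mult_left_mono mult_mono powe_mono) (auto simp: H_def intro:
            SUP_upper)
        finally show ?case by (simp add: mult_ac)
      qed
    qed
    define B where "B x = (\<Sum>k. b k x)" for x
    have [measurable]: "B \<in> borel_measurable M" unfolding B_def by measurable
    have "AE x in M. \<forall>k. ce k (g k) x powe r \<le> ennreal K * (b k x * H x powe (r - s))"
      using ak by (simp add: AE_all_countable)
    then have "AE x in M. S x powe (s / r) * ennreal (w x)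
       \<le> ennreal (K powr (s / r)) * ((B x * ennreal (w x)) powe (s / r) * (H x powe s *
         ennreal (w x)) powe (1 - s / r))"
      using AE_space
    proof eventually_elim
      case (elim x)
      have "S x \<le> (\<Sum>k. ennreal K * (b k x * H x powe (r - s)))"
        unfolding S_def using elim by (intro suminf_le) auto
      also have "\<dots> = ennreal K * (B x * H x powe (r - s))" by (simp add: B_def)
      finally have "S x powe (s / r) \<le> (ennreal K * (B x * H x powe (r - s))) powe (s / r)"
        using s by (intro powe_mono) auto
      \<comment> \<open>The exponent of \<open>H\<close> is
        \<open>(r - s) * (s / r) = s * (1 - s / r)\<close>, which fits the coming Hoelder
        step.\<close>
      also have "\<dots> = ennreal (K powr (s / r)) * (B x powe (s / r) * H x powe (s * (1 - s / r)))"
        using K r by (simp add: powe_mult powe_powe ennreal_powe field_simps)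
      finally have "S x powe (s / r) * ennreal (w x) \<le>
        ennreal (K powr (s / r)) * (B x powe (s / r) * H x powe (s * (1 - s / r))) * ennreal (w x)"
        by (rule mult_right_mono) simp
      also have "\<dots> = ennreal (K powr (s / r)) * (B x powe (s / r) * H x powe (s * (1 - s / r))) *
         (ennreal (w x) powe (s / r) * ennreal (w x) powe (1 - s / r))"
        by (simp flip: powe_add)
      also have "\<dots> = ennreal (K powr (s / r)) * ((B x * ennreal (w x)) powe (s / r) * (H x powe s *
        ennreal (w x)) powe (1 - s / r))"
        by (simp add: powe_mult powe_powe mult_ac)
      finally show ?case .
    qed
    then have "(\<integral>\<^sup>+x. S x powe (s / r) * ennreal (w x) \<partial>M) \<le>
      (\<integral>\<^sup>+x. ennreal (K powr (s / r)) * ((B x * ennreal (w x)) powe (s / r) * (H x powe s *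
        ennreal (w x)) powe (1 - s / r)) \<partial>M)"
      by (rule nn_integral_mono_AE)
    also have "\<dots> = ennreal (K powr (s / r)) * (\<integral>\<^sup>+x. (B x * ennreal (w x)) powe (s / r) *
      (H x powe s * ennreal (w x)) powe (1 - s / r) \<partial>M)"
      by (rule nn_integral_cmult) measurable
    also have "\<dots> \<le> ennreal (K powr (s / r)) * ((\<integral>\<^sup>+x. B x * ennreal (w x) \<partial>M) powe (s / r) *
        (\<integral>\<^sup>+x. H x powe s * ennreal (w x) \<partial>M) powe (1 - s / r))"
      using s by (intro mult_left_mono nn_integral_Hoelder) auto
    also have "\<dots> \<le> ennreal (K powr (s / r)) * (Q powe (s / r) * (ennreal C * Q) powe (1 - s / r))"
    proof (intro mult_left_mono mult_mono powe_mono)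
      have "(\<integral>\<^sup>+x. H x powe s * ennreal (w x) \<partial>M) \<le> ennreal C * (\<integral>\<^sup>+x. f x powe s * ennreal (w x) \<partial>M)"
        unfolding H_def by (rule C(2)[OF _ w]) measurable
      then show "(\<integral>\<^sup>+x. H x powe s * ennreal (w x) \<partial>M) \<le> ennreal C * Q"
        by (simp add: fr Q_def)
      have "(\<integral>\<^sup>+x. B x * ennreal (w x) \<partial>M) = (\<Sum>k. \<integral>\<^sup>+x. b k x * ennreal (w x) \<partial>M)"
        unfolding B_def ennreal_suminf_multc[symmetric] by (rule nn_integral_suminf) measurable
      also have "\<dots> \<le> (\<Sum>k. \<integral>\<^sup>+x. u k x * ennreal (w x) \<partial>M)"
      proof (intro suminf_le)
        fix k
        \<comment> \<open>\<open>b k\<close> is measurable for \<open>F k\<close>, so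
          \<open>w\<close> may be replaced by \<open>W k\<close>, which cancels the denominator of
          \<open>b k\<close>.\<close>
        have "(\<integral>\<^sup>+x. b k x * ennreal (w x) \<partial>M) = (\<integral>\<^sup>+x. b k x * W k x \<partial>M)"
          unfolding W_def by (rule ce_intg[OF bF, symmetric]) measurable
        also have "\<dots> \<le> (\<integral>\<^sup>+x. 1 * ce k (\<lambda>y. u k y * ennreal (w y)) x \<partial>M)"
        proof (intro nn_integral_mono)
          fix x
          show "b k x * W k x \<le> 1 * ce k (\<lambda>y. u k y * ennreal (w y)) x"
            by (cases "W k x = 0 \<or> W k x = top") (auto simp: b_def ennreal_divide_mult_cancel)
        qed
        also have "\<dots> = (\<integral>\<^sup>+x. 1 * (u k x * ennreal (w x)) \<partial>M)" by (rule ce_intg) measurable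
        finally show "(\<integral>\<^sup>+x. b k x * ennreal (w x) \<partial>M) \<le> (\<integral>\<^sup>+x. u k x * ennreal (w x) \<partial>M)" by simp
      qed auto
      also have "\<dots> = (\<integral>\<^sup>+x. (\<Sum>k. u k x * ennreal (w x)) \<partial>M)"
        by (rule nn_integral_suminf[symmetric]) measurable
      also have "\<dots> \<le> Q"
        unfolding Q_def
      proof (rule nn_integral_mono_AE, use finf in eventually_elim)
        case (elim x)
        have "(\<Sum>k. u k x) = P x / f x powe (r - s)"
          unfolding u_def divide_ennreal_def P_def by simp
        also have "\<dots> \<le> f x powe s"
        proof (cases "f x = 0")
          case True
          then show ?thesis using fr(1)[of x] r by simp
        next
          case False
          have "P x = f x powe s * f x powe (r - s)"
            unfolding fr(1)[symmetric] by (simp flip: powe_add)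
          then show ?thesis using False elim mult_divide_eq_ennreal[of "f x powe (r - s)" "f x powe
            s"] by simp
        qed
        finally show ?case unfolding fr(2) by (simp add: mult_right_mono)
      qed
      finally show "(\<integral>\<^sup>+x. B x * ennreal (w x) \<partial>M) \<le> Q" .
    qed (use s in auto)
    also have "\<dots> = ennreal (K powr (s / r) * C powr (1 - s / r)) * Q"
    proof -
      have "Q powe (s / r) * Q powe (1 - s / r) = Q" by (simp flip: powe_add)
      then have "ennreal (K powr (s / r)) * ennreal (C powr (1 - s / r)) * (Q powe (s / r) *
        Q powe (1 - s / r))
         = ennreal (K powr (s / r) * C powr (1 - s / r)) * Q" by (simp add: ennreal_mult)
      then show ?thesis using C(1) by (simp add: powe_mult ennreal_powe mult_ac)
    qed
    finally show "(\<integral>\<^sup>+x. (\<Sum>k. ce k (g k) x powe r) powe (s / r) * ennreal (w x) \<partial>M)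
        \<le> ennreal (K powr (s / r) * C powr (1 - s / r)) * (\<integral>\<^sup>+x. (\<Sum>k. g k x powe r) powe (s / r) *
          ennreal (w x) \<partial>M)"
      unfolding S_def Q_def P_def .
  qed
qed

text \<open>Truncation at \<open>N\<close> and the finite mass of \<open>w\<close> make the
  left-hand side finite, so that it can be absorbed; \<open>C\<close> does not depend on
  \<open>N\<close>. One factor of the power \<open>s / r\<close> is expanded as a series in
  \<open>k\<close>, and the rest is carried by a weight controlled through the maximal function on
  the dual side.\<close>

lemma vector_strong_above:
  assumes s: "1 < r" "r < s" and K: "0 < K"
  obtains C where "0 < C"
    "\<And>w g N. \<lbrakk>A_weight s K w; (\<integral>\<^sup>+x. ennreal (w x) \<partial>M) < top; \<And>k. g k \<in> borel_measurable M\<rbrakk> \<Longrightarrow>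
      (\<integral>\<^sup>+x. min (\<Sum>k. ce k (g k) x powe r) (ennreal N) powe (s / r) * ennreal (w x) \<partial>M)
        \<le> ennreal C * (\<integral>\<^sup>+x. (\<Sum>k. g k x powe r) powe (s / r) * ennreal (w x) \<partial>M)"
proof -
  define s' where "s' = s / (s - 1)"
  \<comment> \<open>This value gives \<open>(s - 1) * (1 - \<theta>) = r - 1\<close>, so that
    \<open>W k\<close> and \<open>V k\<close> combine to a power of their Muckenhoupt product, and
    \<open>s' * (1 - r / s) = \<theta>\<close>, which fits the final Hoelder step.\<close>
  define \<theta> where "\<theta> = (s - r) / (s - 1)"
  have s1: "1 < s" using s by simp
  have s': "1 < s'" using s1 by (simp add: s'_def)
  have th: "0 < \<theta>" "\<theta> < 1" "1 - \<theta> = (r - 1) / (s - 1)" using s by (auto simp: \<theta>_def field_simps)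
  have K': "0 < K powr (1 / (s - 1))" using K by simp
  obtain C where C: "0 < C"
    "\<And>f w. \<lbrakk>f \<in> borel_measurable M; A_weight s' (K powr (1 / (s - 1))) w\<rbrakk> \<Longrightarrow>
      (\<integral>\<^sup>+x. (SUP n. ce n f x) powe s' * ennreal (w x) \<partial>M)
        \<le> ennreal C * (\<integral>\<^sup>+x. f x powe s' * ennreal (w x) \<partial>M)"
    using maximal_A_weight[OF s' K'] by blast
  \<comment> \<open>The first factor comes from \<open>key\<close>, the second from the maximal
    inequality for the dual weight. Absorption raises the product to the power
    \<open>s / r\<close>.\<close>
  define D where "D = K powr (1 - \<theta>) * C powr (1 - r / s)"
  show thesis
  proof
    show "0 < D powr (1 / (r / s))" using C K by (simp add: D_def)
    fix w :: "'a \<Rightarrow> real" and g :: "nat \<Rightarrow> 'a \<Rightarrow> ennreal" and N :: real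
    assume w: "A_weight s K w" and wfin: "(\<integral>\<^sup>+x. ennreal (w x) \<partial>M) < top"
      and [measurable]: "\<And>k. g k \<in> borel_measurable M"
    note [measurable] = A_weightD(1)[OF w]
    note wpos = A_weightD(2)[OF w]
    define \<sigma> where "\<sigma> y = w y powr (- 1 / (s - 1))" for y
    define P where "P x = (\<Sum>k. g k x powe r)" for x
    define a where "a k x = ce k (g k) x powe r" for k x
    define T where "T x = min (\<Sum>k. a k x) (ennreal N)" for x
    \<comment> \<open>The exponent meets two requirements: \<open>T * h powe \<theta>\<close> is
      \<open>T powe (s / r)\<close>, and \<open>hw powe s' * \<sigma>\<close> is
      \<open>T powe (s / r) * w\<close>, so that the maximal inequality for \<open>hw\<close>
      returns \<open>X\<close>.\<close>
    define h where "h x = T x powe ((s - 1) / r)" for x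
    define hw where "hw x = h x * ennreal (w x)" for x
    define H where "H x = (SUP n. ce n hw x)" for x
    define W where "W n = ce n (\<lambda>y. ennreal (w y))" for n
    define V where "V n = ce n (\<lambda>y. ennreal (\<sigma> y))" for n
    define v where "v x = H x powe \<theta> * ennreal (w x powr (1 - \<theta>))" for x
    define X where "X = (\<integral>\<^sup>+x. T x powe (s / r) * ennreal (w x) \<partial>M)"
    define Q where "Q = (\<integral>\<^sup>+x. P x powe (s / r) * ennreal (w x) \<partial>M)"
    have aF: "a k \<in> borel_measurable (F k)" for k unfolding a_def by measurable
    have [measurable]: "a k \<in> borel_measurable M" for k using aF by (rule measurable_F_imp_M)
    have [measurable]: "\<sigma> \<in> borel_measurable M" "P \<in> borel_measurable M" "T \<in> borel_measurable M"
      unfolding \<sigma>_def P_def T_def by measurable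
    have [measurable]: "h \<in> borel_measurable M" unfolding h_def by measurable
    have [measurable]: "hw \<in> borel_measurable M" unfolding hw_def by measurable
    have [measurable]: "H \<in> borel_measurable M" unfolding H_def by measurable
    have [measurable]: "v \<in> borel_measurable M" unfolding v_def by measurable
    have r: "0 < r" using s by simp
    have hth: "h x powe \<theta> = T x powe ((s - r) / r)" for x
      using s by (simp add: h_def powe_powe \<theta>_def)
    have hwth: "hw x powe \<theta> * ennreal (w x) powe (1 - \<theta>)
      = T x powe ((s - r) / r) * ennreal (w x)" if "x \<in> space M" for x
      using wpos[OF that] by (simp add: hw_def powe_mult hth mult.assoc flip: powe_add)

    have "X \<le> (\<integral>\<^sup>+x. ennreal N powe (s / r) * ennreal (w x) \<partial>M)"
      unfolding X_def using s by (intro nn_integral_mono mult_right_mono powe_mono) (auto simp: T_def)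
    also have "\<dots> < top"
      using wfin by (simp add: nn_integral_cmult ennreal_mult_less_top)
    finally have Xfin: "X \<noteq> top" by simp

    \<comment> \<open>Conditional Hoelder is used twice: once to split \<open>hw\<close> from
      \<open>w\<close>, and once to bound \<open>ce k (g k)\<close> times a power of
      \<open>A\<close>. The conditional expectations of the weights that remain form the power
      \<open>1 - \<theta>\<close> of the Muckenhoupt product.\<close>
    have key: "AE x in M. a k x * ce k (\<lambda>x. T x powe ((s - r) / r) * ennreal (w x)) x
        \<le> ennreal (K powr (1 - \<theta>)) * ce k (\<lambda>x. g k x powe r * v x) x" for k
    proof -
      define A where "A = ce k hw"
      have AF: "(\<lambda>x. A x powe (\<theta> / r)) \<in> borel_measurable (F k)" unfolding A_def by measurable
      have [measurable]: "A \<in> borel_measurable M" unfolding A_def by measurable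
      have "AE x in M. ce k (\<lambda>x. T x powe ((s - r) / r) * ennreal (w x)) x
           = ce k (\<lambda>x. hw x powe \<theta> * ennreal (w x) powe (1 - \<theta>)) x"
        by (rule ce_cong, rule AE_I2) (simp_all add: hwth)
      moreover have "AE x in M. ce k (\<lambda>x. hw x powe \<theta> * ennreal (w x) powe (1 - \<theta>)) x
          \<le> A x powe \<theta> * W k x powe (1 - \<theta>)"
        unfolding A_def W_def using th by (intro ce_Hoelder) auto
      moreover have "AE x in M. A x powe (\<theta> / r) * ce k (g k) x = ce k (\<lambda>x. A x powe (\<theta> / r) * g k x) x"
        by (rule ce_prod[OF AF]) measurable
      moreover have "AE x in M. ce k (\<lambda>x. A x powe (\<theta> / r) * g k x) x
          \<le> ce k (\<lambda>x. (g k x powe r * v x) powe (1 / r) * ennreal (\<sigma> x) powe (1 - 1 / r)) x"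
      proof (rule ce_mono, rule AE_I2)
        fix x assume x: "x \<in> space M"
        have e: "(1 - \<theta>) * (1 / r) + (- 1 / (s - 1)) * (1 - 1 / r) = 0"
          unfolding th(3) using r s1 by (simp add: field_simps)
        have ws: "ennreal (w x powr (1 - \<theta>)) powe (1 / r) * ennreal (\<sigma> x) powe (1 - 1 / r) = 1"
          unfolding \<sigma>_def weight_powe[OF wpos[OF x]] weight_mult[OF wpos[OF x]] e using wpos[OF x]
            by simp
        \<comment> \<open>Once inside the conditional expectation, \<open>A\<close> is replaced by
          the larger \<open>H\<close>. The resulting weight \<open>v\<close> is the same for all
          \<open>k\<close>, and this allows the summation over \<open>k\<close> later.\<close>
        have "A x \<le> H x" unfolding A_def H_def by (rule SUP_upper) simp
        then have "A x powe (\<theta> / r) * g k x \<le> H x powe (\<theta> / r) * g k x"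
          using th r by (intro mult_right_mono powe_mono) auto
        also have "\<dots> = (g k x powe r) powe (1 / r) * (H x powe \<theta>) powe (1 / r) *
           (ennreal (w x powr (1 - \<theta>)) powe (1 / r) * ennreal (\<sigma> x) powe (1 - 1 / r))"
          unfolding ws using r by (simp add: powe_powe mult.commute)
        also have "\<dots> = (g k x powe r * v x) powe (1 / r) * ennreal (\<sigma> x) powe (1 - 1 / r)"
          unfolding v_def by (simp only: powe_mult mult_ac)
        finally show "A x powe (\<theta> / r) * g k x
          \<le> (g k x powe r * v x) powe (1 / r) * ennreal (\<sigma> x) powe (1 - 1 / r)" .
      qed measurable
      moreover have "AE x in M. ce k (\<lambda>x. (g k x powe r * v x) powe (1 / r) *
        ennreal (\<sigma> x) powe (1 - 1 / r)) x
          \<le> ce k (\<lambda>x. g k x powe r * v x) x powe (1 / r) * V k x powe (1 - 1 / r)"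
        unfolding V_def using s by (intro ce_Hoelder) auto
      ultimately show ?thesis
        using A_weight_bounds[OF w, of k] unfolding \<sigma>_def[symmetric] W_def[symmetric] V_def[symmetric]
      proof eventually_elim
        case (elim x)
        let ?U = "ce k (\<lambda>x. g k x powe r * v x) x"
        have "A x powe (\<theta> / r) * ce k (g k) x \<le> ?U powe (1 / r) * V k x powe (1 - 1 / r)"
          using elim by simp
        then have "(A x powe (\<theta> / r) * ce k (g k) x) powe r
          \<le> (?U powe (1 / r) * V k x powe (1 - 1 / r)) powe r"
          using r by (intro powe_mono) auto
        moreover have "(1 - 1 / r) * r = r - 1" using r by (simp add: field_simps)
        ultimately have 1: "A x powe \<theta> * a k x \<le> ?U * V k x powe (r - 1)"
          using r by (simp add: powe_mult powe_powe a_def)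
        have "(s - 1) * (1 - \<theta>) = r - 1" unfolding th(3) using s1 by simp
        then have 2: "W k x powe (1 - \<theta>) * V k x powe (r - 1)
          = (W k x * V k x powe (s - 1)) powe (1 - \<theta>)"
          by (simp add: powe_mult powe_powe)
        have "a k x * ce k (\<lambda>x. T x powe ((s - r) / r) * ennreal (w x)) x
          \<le> a k x * (A x powe \<theta> * W k x powe (1 - \<theta>))"
          using elim by (intro mult_left_mono) auto
        also have "\<dots> = (A x powe \<theta> * a k x) * W k x powe (1 - \<theta>)" by (simp add: mult_ac)
        also have "\<dots> \<le> (?U * V k x powe (r - 1)) * W k x powe (1 - \<theta>)" using 1
          by (rule mult_right_mono) simp
        also have "\<dots> = ?U * (W k x powe (1 - \<theta>) * V k x powe (r - 1))" by (simp add: mult_ac)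
        also have "\<dots> \<le> ?U * ennreal K powe (1 - \<theta>)"
          unfolding 2 using elim th by (intro mult_left_mono powe_mono) auto
        finally show ?case using K by (simp add: ennreal_powe mult.commute)
      qed
    qed

    have "X \<le> (\<integral>\<^sup>+x. (\<Sum>k. a k x * (T x powe ((s - r) / r) * ennreal (w x))) \<partial>M)"
      unfolding X_def
    proof (rule nn_integral_mono)
      fix x
      have "1 + (s - r) / r = s / r" using r by (simp add: field_simps)
      then have "T x powe (s / r) = T x * T x powe ((s - r) / r)" by (metis powe_add powe_one)
      also have "\<dots> \<le> (\<Sum>k. a k x) * T x powe ((s - r) / r)"
        by (intro mult_right_mono) (auto simp: T_def)
      finally show "T x powe (s / r) * ennreal (w x)
        \<le> (\<Sum>k. a k x * (T x powe ((s - r) / r) * ennreal (w x)))"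
        by (simp add: mult_right_mono mult.assoc[symmetric])
    qed
    also have "\<dots> = (\<Sum>k. \<integral>\<^sup>+x. a k x * (T x powe ((s - r) / r) * ennreal (w x)) \<partial>M)"
      by (rule nn_integral_suminf) measurable
    also have "\<dots> \<le> (\<Sum>k. ennreal (K powr (1 - \<theta>)) * (\<integral>\<^sup>+x. g k x powe r * v x \<partial>M))"
    proof (intro suminf_le)
      fix k
      \<comment> \<open>\<open>a k\<close> is measurable for \<open>F k\<close>, so the other factor
        may be replaced by its conditional expectation, and \<open>key\<close> applies.\<close>
      have "(\<integral>\<^sup>+x. a k x * (T x powe ((s - r) / r) * ennreal (w x)) \<partial>M)
         = (\<integral>\<^sup>+x. a k x * ce k (\<lambda>x. T x powe ((s - r) / r) * ennreal (w x)) x \<partial>M)"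
        by (rule ce_intg[OF aF, symmetric]) measurable
      also have "\<dots> \<le> (\<integral>\<^sup>+x. ennreal (K powr (1 - \<theta>)) * ce k (\<lambda>x. g k x powe r * v x) x \<partial>M)"
        by (rule nn_integral_mono_AE[OF key])
      also have "\<dots> = (\<integral>\<^sup>+x. ennreal (K powr (1 - \<theta>)) * (g k x powe r * v x) \<partial>M)"
        by (rule ce_intg) measurable
      also have "\<dots> = ennreal (K powr (1 - \<theta>)) * (\<integral>\<^sup>+x. g k x powe r * v x \<partial>M)"
        by (rule nn_integral_cmult) measurable
      finally show "(\<integral>\<^sup>+x. a k x * (T x powe ((s - r) / r) * ennreal (w x)) \<partial>M)
        \<le> ennreal (K powr (1 - \<theta>)) * (\<integral>\<^sup>+x. g k x powe r * v x \<partial>M)" .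
    qed auto
    also have "\<dots> = ennreal (K powr (1 - \<theta>)) * (\<integral>\<^sup>+x. (\<Sum>k. g k x powe r * v x) \<partial>M)"
      unfolding ennreal_suminf_cmult by (subst nn_integral_suminf) auto
    also have "(\<integral>\<^sup>+x. (\<Sum>k. g k x powe r * v x) \<partial>M)
       = (\<integral>\<^sup>+x. (P x powe (s / r) * ennreal (w x)) powe (r / s) * (H x powe s' *
         ennreal (\<sigma> x)) powe (1 - r / s) \<partial>M)"
    proof (intro nn_integral_cong)
      fix x assume x: "x \<in> space M"
      have e: "1 * (r / s) + (- 1 / (s - 1)) * (1 - r / s) = 1 - \<theta>"
        unfolding th(3) using s by (simp add: field_simps)
      have e2: "s' * (1 - r / s) = \<theta>" using s by (simp add: s'_def \<theta>_def field_simps)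
      have "(P x powe (s / r) * ennreal (w x)) powe (r / s) * (H x powe s' *
        ennreal (\<sigma> x)) powe (1 - r / s)
        = P x powe (s / r * (r / s)) * H x powe (s' * (1 - r / s)) *
          (ennreal (w x powr 1) powe (r / s) * ennreal (\<sigma> x) powe (1 - r / s))"
        unfolding weight_one[OF wpos[OF x], symmetric] by (simp only: powe_mult powe_powe mult_ac)
      also have "\<dots> = P x * v x"
        unfolding \<sigma>_def weight_powe[OF wpos[OF x]] weight_mult[OF wpos[OF x]] e e2
        using s by (simp add: v_def mult.assoc)
      finally show "(\<Sum>k. g k x powe r * v x)
         = (P x powe (s / r) * ennreal (w x)) powe (r / s) * (H x powe s' *
           ennreal (\<sigma> x)) powe (1 - r / s)"
        by (simp add: P_def)
    qed
    also have "\<dots> \<le> Q powe (r / s) * (\<integral>\<^sup>+x. H x powe s' * ennreal (\<sigma> x) \<partial>M) powe (1 - r / s)"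
      unfolding Q_def using s by (intro nn_integral_Hoelder) auto
    also have "\<dots> \<le> Q powe (r / s) * (ennreal C * X) powe (1 - r / s)"
    proof (intro mult_left_mono powe_mono)
      have "(\<integral>\<^sup>+x. H x powe s' * ennreal (\<sigma> x) \<partial>M)
        \<le> ennreal C * (\<integral>\<^sup>+x. hw x powe s' * ennreal (\<sigma> x) \<partial>M)"
        unfolding H_def \<sigma>_def
        by (rule C(2)) (use A_weight_dual[OF s1 K w] in \<open>auto simp: s'_def\<close>)
      also have "(\<integral>\<^sup>+x. hw x powe s' * ennreal (\<sigma> x) \<partial>M) = X"
        unfolding X_def
      proof (intro nn_integral_cong)
        fix x assume x: "x \<in> space M"
        have e: "1 * s' + - 1 / (s - 1) = 1" using s1
          by (simp add: s'_def diff_divide_distrib[symmetric])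
        have e2: "(s - 1) / r * s' = s / r" using s by (simp add: s'_def)
        have "hw x powe s' * ennreal (\<sigma> x) = T x powe ((s - 1) / r * s') *
          (ennreal (w x powr 1) powe s' * ennreal (\<sigma> x))"
          unfolding weight_one[OF wpos[OF x], symmetric]
            by (simp only: hw_def h_def powe_mult powe_powe mult_ac)
        also have "\<dots> = T x powe (s / r) * ennreal (w x)"
          unfolding \<sigma>_def weight_powe[OF wpos[OF x]] weight_mult[OF wpos[OF x]] e e2 using wpos[OF x]
            by simp
        finally show "hw x powe s' * ennreal (\<sigma> x) = T x powe (s / r) * ennreal (w x)" .
      qed
      finally show "(\<integral>\<^sup>+x. H x powe s' * ennreal (\<sigma> x) \<partial>M) \<le> ennreal C * X" .
    qed (use s in auto)
    also have "ennreal (K powr (1 - \<theta>)) * (Q powe (r / s) * (ennreal C * X) powe (1 - r / s))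
       = ennreal D * Q powe (r / s) * X powe (1 - r / s)"
      unfolding D_def using C(1) by (simp add: powe_mult ennreal_powe ennreal_mult mult_ac)
    finally have "X \<le> ennreal D * Q powe (r / s) * X powe (1 - r / s)" by (simp add: mult_left_mono)
    then have "X \<le> ennreal D powe (1 / (r / s)) * Q"
      using s Xfin by (intro powe_absorb) auto
    also have "ennreal D powe (1 / (r / s)) = ennreal (D powr (1 / (r / s)))"
      using C(1) K by (intro ennreal_powe) (simp add: D_def)
    finally show "(\<integral>\<^sup>+x. min (\<Sum>k. ce k (g k) x powe r) (ennreal N) powe (s / r) * ennreal (w x) \<partial>M)
        \<le> ennreal (D powr (1 / (r / s))) * (\<integral>\<^sup>+x. (\<Sum>k. g k x powe r) powe (s / r) * ennreal (w x) \<partial>M)"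
      unfolding X_def Q_def P_def T_def a_def .
  qed
qed

text \<open>Chebyshev's inequality for the sum truncated at height \<open>l powr r\<close>: where
  the sum exceeds this height the truncation equals it, and its power \<open>s / r\<close> is
  \<open>l powr s\<close>. The truncated estimate therefore suffices when
  \<open>r < s\<close>.\<close>

lemma vector_weak:
  assumes s: "1 < s" and r: "1 < r" "s \<noteq> r" and K: "0 < K"
  obtains C where "0 < C"
    "\<And>w g l. \<lbrakk>A_weight s K w; (\<integral>\<^sup>+x. ennreal (w x) \<partial>M) < top; \<And>k. g k \<in> borel_measurable M;
       AE x in M. (\<Sum>k. g k x powe r) \<noteq> top; 0 < l\<rbrakk> \<Longrightarrow>
      ennreal (l powr s) * (\<integral>\<^sup>+x. ennreal (w x) *
        indicator {ennreal (l powr r)<..} (\<Sum>k. ce k (g k) x powe r) \<partial>M)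
        \<le> ennreal C * (\<integral>\<^sup>+x. (\<Sum>k. g k x powe r) powe (s / r) * ennreal (w x) \<partial>M)"
proof -
  have main: "ennreal (l powr s) * (\<integral>\<^sup>+x. ennreal (w x) * indicator {ennreal (l powr r)<..} (S x) \<partial>M)
      \<le> (\<integral>\<^sup>+x. min (S x) (ennreal (l powr r)) powe (s / r) * ennreal (w x) \<partial>M)"
    if [measurable]: "S \<in> borel_measurable M" "w \<in> borel_measurable M" and "0 < l" for l S and w ::
      "'a \<Rightarrow> real"
  proof -
    have "ennreal (l powr s) * (\<integral>\<^sup>+x. ennreal (w x) * indicator {ennreal (l powr r)<..} (S x) \<partial>M)
      = (\<integral>\<^sup>+x. ennreal (l powr s) * (ennreal (w x) * indicator {ennreal (l powr r)<..} (S x)) \<partial>M)"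
      by (rule nn_integral_cmult[symmetric]) measurable
    also have "\<dots> \<le> (\<integral>\<^sup>+x. min (S x) (ennreal (l powr r)) powe (s / r) * ennreal (w x) \<partial>M)"
    proof (intro nn_integral_mono)
      fix x
      have "ennreal (l powr r) powe (s / r) = ennreal (l powr s)"
        using r that(3) by (simp add: ennreal_powe powr_powr)
      then show "ennreal (l powr s) * (ennreal (w x) * indicator {ennreal (l powr r)<..} (S x))
         \<le> min (S x) (ennreal (l powr r)) powe (s / r) * ennreal (w x)"
        by (auto simp: min_def split: split_indicator)
    qed
    finally show ?thesis .
  qed
  show thesis
  proof (cases "s < r")
    case True
    obtain C where C: "0 < C"
     "\<And>w g. \<lbrakk>A_weight s K w; \<And>k. g k \<in> borel_measurable M; AE x in M. (\<Sum>k. g k x powe r) \<noteq> top\<rbrakk> \<Longrightarrow>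
      (\<integral>\<^sup>+x. (\<Sum>k. ce k (g k) x powe r) powe (s / r) * ennreal (w x) \<partial>M)
        \<le> ennreal C * (\<integral>\<^sup>+x. (\<Sum>k. g k x powe r) powe (s / r) * ennreal (w x) \<partial>M)"
      using vector_strong_below[OF s True K] by blast
    show thesis
    proof (rule that[OF C(1)])
      fix w and g :: "nat \<Rightarrow> 'a \<Rightarrow> ennreal" and l :: real
      assume w: "A_weight s K w" and [measurable]: "\<And>k. g k \<in> borel_measurable M"
        and fin: "AE x in M. (\<Sum>k. g k x powe r) \<noteq> top" and l: "0 < l"
      note [measurable] = A_weightD(1)[OF w]
      have "ennreal (l powr s) * (\<integral>\<^sup>+x. ennreal (w x) *
        indicator {ennreal (l powr r)<..} (\<Sum>k. ce k (g k) x powe r) \<partial>M)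
         \<le> (\<integral>\<^sup>+x. min (\<Sum>k. ce k (g k) x powe r) (ennreal (l powr r)) powe (s / r) * ennreal (w x) \<partial>M)"
        using l by (intro main) auto
      also have "\<dots> \<le> (\<integral>\<^sup>+x. (\<Sum>k. ce k (g k) x powe r) powe (s / r) * ennreal (w x) \<partial>M)"
        using s r by (intro nn_integral_mono mult_right_mono powe_mono) auto
      also have "\<dots> \<le> ennreal C * (\<integral>\<^sup>+x. (\<Sum>k. g k x powe r) powe (s / r) * ennreal (w x) \<partial>M)"
        using fin by (intro C(2) w) auto
      finally show "ennreal (l powr s) * (\<integral>\<^sup>+x. ennreal (w x) *
        indicator {ennreal (l powr r)<..} (\<Sum>k. ce k (g k) x powe r) \<partial>M)
        \<le> ennreal C * (\<integral>\<^sup>+x. (\<Sum>k. g k x powe r) powe (s / r) * ennreal (w x) \<partial>M)" .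
    qed
  next
    case False
    then have "r < s" using r by simp
    obtain C where C: "0 < C"
     "\<And>w g N. \<lbrakk>A_weight s K w; (\<integral>\<^sup>+x. ennreal (w x) \<partial>M) < top; \<And>k. g k \<in> borel_measurable M\<rbrakk> \<Longrightarrow>
      (\<integral>\<^sup>+x. min (\<Sum>k. ce k (g k) x powe r) (ennreal N) powe (s / r) * ennreal (w x) \<partial>M)
        \<le> ennreal C * (\<integral>\<^sup>+x. (\<Sum>k. g k x powe r) powe (s / r) * ennreal (w x) \<partial>M)"
      using vector_strong_above[OF r(1) \<open>r < s\<close> K] by blast
    show thesis
    proof (rule that[OF C(1)])
      fix w and g :: "nat \<Rightarrow> 'a \<Rightarrow> ennreal" and l :: real
      assume w: "A_weight s K w" "(\<integral>\<^sup>+x. ennreal (w x) \<partial>M) < top"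
        and [measurable]: "\<And>k. g k \<in> borel_measurable M" and l: "0 < l"
      note [measurable] = A_weightD(1)[OF w(1)]
      have "ennreal (l powr s) * (\<integral>\<^sup>+x. ennreal (w x) *
        indicator {ennreal (l powr r)<..} (\<Sum>k. ce k (g k) x powe r) \<partial>M)
         \<le> (\<integral>\<^sup>+x. min (\<Sum>k. ce k (g k) x powe r) (ennreal (l powr r)) powe (s / r) * ennreal (w x) \<partial>M)"
        using l by (intro main) auto
      also have "\<dots> \<le> ennreal C * (\<integral>\<^sup>+x. (\<Sum>k. g k x powe r) powe (s / r) * ennreal (w x) \<partial>M)"
        by (intro C(2) w) auto
      finally show "ennreal (l powr s) * (\<integral>\<^sup>+x. ennreal (w x) *
        indicator {ennreal (l powr r)<..} (\<Sum>k. ce k (g k) x powe r) \<partial>M)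
        \<le> ennreal C * (\<integral>\<^sup>+x. (\<Sum>k. g k x powe r) powe (s / r) * ennreal (w x) \<partial>M)" .
    qed
  qed
qed

subsection \<open>Interpolation between two exponents\<close>

text \<open>The dual weight for \<open>s\<close> is the power \<open>(q - 1) / (s - 1) < 1\<close>
  of the one for \<open>q\<close>, so conditional Hoelder against the constant one gives the
  condition with the same \<open>K\<close>.\<close>

lemma A_weight_mono:
  assumes q: "1 < q" "q < s" and w: "A_weight q K w"
  shows "A_weight s K w"
  unfolding A_weight_def
proof (intro conjI ballI allI)
  note [measurable] = A_weightD(1)[OF w]
  note wpos = A_weightD(2)[OF w]
  show "w \<in> borel_measurable M" "\<And>x. x \<in> space M \<Longrightarrow> 0 < w x" using wpos by auto
  fix n
  let ?a = "(q - 1) / (s - 1)"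
  have a: "0 < ?a" "0 < 1 - ?a" "?a * (s - 1) = q - 1" using q by (auto simp: field_simps)
  let ?\<sigma> = "\<lambda>q y. ennreal (w y powr (- 1 / (q - 1)))"
  have "AE x in M. ce n (?\<sigma> s) x = ce n (\<lambda>y. ?\<sigma> q y powe ?a * 1 powe (1 - ?a)) x"
  proof (rule ce_cong, rule AE_I2)
    fix x assume x: "x \<in> space M"
    have "- 1 / (q - 1) * ?a = - 1 / (s - 1)" using q by (simp add: field_simps)
    then show "?\<sigma> s x = ?\<sigma> q x powe ?a * 1 powe (1 - ?a)"
      unfolding weight_powe[OF wpos[OF x]] by (simp only: one_powe mult_1_right)
  qed measurable
  moreover have "AE x in M. ce n (\<lambda>y. ?\<sigma> q y powe ?a * 1 powe (1 - ?a)) x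
      \<le> ce n (?\<sigma> q) x powe ?a * ce n (\<lambda>x. 1) x powe (1 - ?a)"
    using a by (intro ce_Hoelder) auto
  moreover have "AE x in M. 1 = ce n (\<lambda>x. 1) x" by (rule ce_F_meas) simp
  ultimately show "AE x in M. ce n (\<lambda>y. ennreal (w y)) x * ce n (?\<sigma> s) x powe (s - 1) \<le> ennreal K"
    using A_weightD(3)[OF w, of n]
  proof eventually_elim
    case (elim x)
    have "ce n (?\<sigma> s) x \<le> ce n (?\<sigma> q) x powe ?a"
      using elim(1,2) by (simp flip: elim(3))
    then have "ce n (?\<sigma> s) x powe (s - 1) \<le> (ce n (?\<sigma> q) x powe ?a) powe (s - 1)"
      using q by (intro powe_mono) auto
    then have "ce n (\<lambda>y. ennreal (w y)) x * ce n (?\<sigma> s) x powe (s - 1)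
       \<le> ce n (\<lambda>y. ennreal (w y)) x * ce n (?\<sigma> q) x powe (q - 1)"
      unfolding powe_powe a(3) by (rule mult_left_mono) simp
    then show ?case using elim(4) by (rule order_trans)
  qed
qed

text \<open>The hypothesis bounds \<open>W powe (1 / (q - 1))\<close> times the dual weight
  pointwise by a constant. The first factor is measurable for \<open>F n\<close> and leaves the
  conditional expectation.\<close>

lemma A_weight_of_A1:
  assumes q: "1 < q" and K: "0 < K" and [measurable]: "w \<in> borel_measurable M"
    and wpos: "\<And>x. x \<in> space M \<Longrightarrow> 0 < w x"
    and A1: "\<And>n. AE x in M. ce n (\<lambda>y. ennreal (w y)) x \<le> ennreal K * ennreal (w x)"
  shows "A_weight q K w"
  unfolding A_weight_def
proof (intro conjI ballI allI)
  show "w \<in> borel_measurable M" "\<And>x. x \<in> space M \<Longrightarrow> 0 < w x" using wpos by auto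
  fix n
  define W where "W = ce n (\<lambda>y. ennreal (w y))"
  let ?b = "1 / (q - 1)"
  let ?\<sigma> = "\<lambda>y. ennreal (w y powr (- 1 / (q - 1)))"
  have WF: "(\<lambda>x. W x powe ?b) \<in> borel_measurable (F n)" unfolding W_def by measurable
  have [measurable]: "W \<in> borel_measurable M" unfolding W_def by measurable
  have "AE x in M. W x powe ?b * ?\<sigma> x \<le> ennreal K powe ?b"
    using A1[of n] AE_space unfolding W_def[symmetric]
  proof eventually_elim
    case (elim x)
    note p = wpos[OF elim(2)]
    have ws: "ennreal (w x) powe ?b * ?\<sigma> x = 1"
      using p by (simp add: ennreal_powe weight_mult)
    have "W x powe ?b * ?\<sigma> x \<le> (ennreal K * ennreal (w x)) powe ?b * ?\<sigma> x"
      using elim q by (intro mult_right_mono powe_mono) auto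
    also have "\<dots> = ennreal K powe ?b * (ennreal (w x) powe ?b * ?\<sigma> x)"
      by (simp only: powe_mult mult_ac)
    finally show ?case unfolding ws by simp
  qed
  then have "AE x in M. ce n (\<lambda>x. W x powe ?b * ?\<sigma> x) x \<le> ce n (\<lambda>x. ennreal K powe ?b) x"
    by (rule ce_mono) measurable
  moreover have "AE x in M. ennreal K powe ?b = ce n (\<lambda>x. ennreal K powe ?b) x"
    by (rule ce_F_meas) simp
  moreover have "AE x in M. W x powe ?b * ce n ?\<sigma> x = ce n (\<lambda>x. W x powe ?b * ?\<sigma> x) x"
    by (rule ce_prod[OF WF]) measurable
  ultimately show "AE x in M. ce n (\<lambda>y. ennreal (w y)) x * ce n ?\<sigma> x powe (q - 1) \<le> ennreal K"
    unfolding W_def[symmetric]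
  proof eventually_elim
    case (elim x)
    then have "(W x powe ?b * ce n ?\<sigma> x) powe (q - 1) \<le> (ennreal K powe ?b) powe (q - 1)"
      using q by (intro powe_mono) auto
    then show ?case using q by (simp add: powe_mult powe_powe)
  qed
qed

text \<open>The strict inequality \<open>q < s\<close> lets the case \<open>q = 1\<close> enter
  through \<open>A_weight_of_A1\<close>. The constant is fixed before \<open>t\<close>, which gives
  the uniformity required for summing over dyadic levels.\<close>

lemma MO_A_imp_A_weight:
  assumes \<phi>: "musielak_orlicz M \<phi>" and q: "1 \<le> q" "q < s" and A: "MO_A M F q \<phi>"
  obtains K where "0 < K" "\<And>t. 0 < t \<Longrightarrow> A_weight s K (\<lambda>x. \<phi> x t)"
proof -
  have meas: "(\<lambda>x. \<phi> x t) \<in> borel_measurable M" "\<And>x. x \<in> space M \<Longrightarrow> 0 < \<phi> x t" if "0 < t" for t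
    using \<phi> that by (auto simp: musielak_orlicz_def)
  show thesis
  proof (cases "q = 1")
    case True
    then obtain K where K: "\<And>n t. 0 < t \<Longrightarrow> AE x in M. ce n (\<lambda>y. ennreal (\<phi> y t)) x
      \<le> ennreal K * ennreal (\<phi> x t)"
      using A by (auto simp: MO_A_def)
    show thesis
    \<comment> \<open>The constant in \<open>MO_A\<close> has no prescribed sign, so it is enlarged
      to a positive one.\<close>
    proof (rule that[of "max K 1"])
      fix t :: real assume t: "0 < t"
      have "AE x in M. ce n (\<lambda>y. ennreal (\<phi> y t)) x \<le> ennreal (max K 1) * ennreal (\<phi> x t)" for n
        using K[OF t, of n]
      proof eventually_elim
        case (elim x)
        have "ennreal K * ennreal (\<phi> x t) \<le> ennreal (max K 1) * ennreal (\<phi> x t)"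
          by (intro mult_right_mono ennreal_leI) auto
        with elim show ?case by (rule order_trans)
      qed
      then show "A_weight s (max K 1) (\<lambda>x. \<phi> x t)"
        using q True meas[OF t] by (intro A_weight_of_A1) auto
    qed simp
  next
    case False
    then obtain K where K: "\<And>n t. 0 < t \<Longrightarrow> AE x in M. ce n (\<lambda>y. ennreal (\<phi> y t)) x *
        ce n (\<lambda>y. ennreal (\<phi> y t powr (- 1 / (q - 1)))) x powe (q - 1) \<le> ennreal K"
      using A by (auto simp: MO_A_def)
    show thesis
    proof (rule that[of "max K 1"])
      fix t :: real assume t: "0 < t"
      have "A_weight q (max K 1) (\<lambda>x. \<phi> x t)"
        unfolding A_weight_def
      proof (intro conjI ballI allI)
        fix n
        show "AE x in M. ce n (\<lambda>y. ennreal (\<phi> y t)) x *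
          ce n (\<lambda>y. ennreal (\<phi> y t powr (- 1 / (q - 1)))) x powe (q - 1) \<le> ennreal (max K 1)"
          using K[OF t, of n]
        proof eventually_elim
          case (elim x)
          also have "ennreal K \<le> ennreal (max K 1)" by (rule ennreal_leI) simp
          finally show ?case .
        qed
      qed (use meas[OF t] in auto)
      then show "A_weight s (max K 1) (\<lambda>x. \<phi> x t)"
        by (rule A_weight_mono[rotated 2]) (use q False in auto)
    qed simp
  qed
qed

text \<open>The weak inequality for the sequence cut off to \<open>E\<close>, normalised for the
  splitting argument: level \<open>t\<close> for functions divided by \<open>c\<close> becomes level
  \<open>c * t / 4\<close>, the quarter being the loss when a sum is split in two.\<close>

lemma vector_weak_restricted:
  assumes s: "1 < s" and r: "1 < r" "s \<noteq> r" and K: "0 < K"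
  obtains C where "0 < C"
    "\<And>w g E c t. \<lbrakk>A_weight s K w; (\<integral>\<^sup>+x. ennreal (w x) \<partial>M) < top; \<And>k. g k \<in> borel_measurable M;
       AE x in M. (\<Sum>k. g k x powe r) \<noteq> top; E \<in> sets M; 0 < c; 0 < t\<rbrakk> \<Longrightarrow>
      (\<integral>\<^sup>+x. ennreal (w x) * indicator {ennreal ((c * t / 4) powr r)<..} (\<Sum>k. ce k (\<lambda>x. g k x *
        indicator E x) x powe r) \<partial>M)
        \<le> ennreal C * (ennreal (t powr (- s)) *
           (\<integral>\<^sup>+x. ((\<Sum>k. g k x powe r) powe (1 / r) / ennreal c) powe s * indicator E x *
             ennreal (w x) \<partial>M))"
proof -
  obtain C where C: "0 < C"
    "\<And>w g l. \<lbrakk>A_weight s K w; (\<integral>\<^sup>+x. ennreal (w x) \<partial>M) < top; \<And>k. g k \<in> borel_measurable M;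
       AE x in M. (\<Sum>k. g k x powe r) \<noteq> top; 0 < l\<rbrakk> \<Longrightarrow>
      ennreal (l powr s) * (\<integral>\<^sup>+x. ennreal (w x) *
        indicator {ennreal (l powr r)<..} (\<Sum>k. ce k (g k) x powe r) \<partial>M)
        \<le> ennreal C * (\<integral>\<^sup>+x. (\<Sum>k. g k x powe r) powe (s / r) * ennreal (w x) \<partial>M)"
    using vector_weak[OF s r K] by blast
  show thesis
  \<comment> \<open>For \<open>l = c * t / 4\<close> the product
    \<open>l powr (- s) * c powr s\<close> equals \<open>4 powr s * t powr (- s)\<close>.\<close>
  proof (rule that[of "C * 4 powr s"])
    show "0 < C * 4 powr s" using C by simp
    fix w :: "'a \<Rightarrow> real" and g :: "nat \<Rightarrow> 'a \<Rightarrow> ennreal" and E and c t :: real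
    assume w: "A_weight s K w" "(\<integral>\<^sup>+x. ennreal (w x) \<partial>M) < top" and [measurable]: "\<And>k. g k \<in>
      borel_measurable M"
      and fin: "AE x in M. (\<Sum>k. g k x powe r) \<noteq> top" and [measurable]: "E \<in> sets M" and ct: "0 < c" "0
        < t"
    note [measurable] = A_weightD(1)[OF w(1)]
    define P where "P x = (\<Sum>k. g k x powe r)" for x
    have [measurable]: "P \<in> borel_measurable M" unfolding P_def by measurable
    let ?g = "\<lambda>k x. g k x * indicator E x"
    have PE: "(\<Sum>k. ?g k x powe r) = P x * indicator E x" for x
      by (auto simp: P_def split: split_indicator)
    define l where "l = c * t / 4"
    have l: "0 < l" using ct by (simp add: l_def)
    let ?I = "\<integral>\<^sup>+x. ennreal (w x) * indicator {ennreal (l powr r)<..} (\<Sum>k. ce k (?g k) x powe r) \<partial>M"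
    let ?J = "\<integral>\<^sup>+x. (P x powe (1 / r) / ennreal c) powe s * indicator E x * ennreal (w x) \<partial>M"
    have "AE x in M. (\<Sum>k. ?g k x powe r) \<noteq> top"
      using fin unfolding PE by eventually_elim (auto simp: P_def split: split_indicator)
    then have "ennreal (l powr s) * ?I \<le> ennreal C * (\<integral>\<^sup>+x. (\<Sum>k. ?g k x powe r) powe (s / r) *
      ennreal (w x) \<partial>M)"
      using w l by (intro C(2)) auto
    also have "(\<integral>\<^sup>+x. (\<Sum>k. ?g k x powe r) powe (s / r) * ennreal (w x) \<partial>M)
      = (\<integral>\<^sup>+x. ennreal (c powr s) * ((P x powe (1 / r) / ennreal c) powe s * indicator E x *
        ennreal (w x)) \<partial>M)"
    proof (rule nn_integral_cong)
      fix x
      have "ennreal (c powr s) * (P x powe (1 / r) / ennreal c) powe s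
        = (P x powe (1 / r) / ennreal c * ennreal c) powe s"
        using ct by (simp add: powe_mult ennreal_powe mult.commute)
      also have "\<dots> = P x powe (s / r)" using ct by (simp add: ennreal_divide_mult_cancel powe_powe)
      finally show "(\<Sum>k. ?g k x powe r) powe (s / r) * ennreal (w x)
        = ennreal (c powr s) * ((P x powe (1 / r) / ennreal c) powe s * indicator E x * ennreal (w x))"
        unfolding PE by (auto simp: mult.assoc[symmetric] split: split_indicator)
    qed
    also have "\<dots> = ennreal (c powr s) * ?J" by (rule nn_integral_cmult) measurable
    finally have "ennreal (l powr (- s)) * (ennreal (l powr s) * ?I)
        \<le> ennreal (l powr (- s)) * (ennreal C * (ennreal (c powr s) * ?J))"
          by (rule mult_left_mono) simp
    moreover have "ennreal (l powr (- s)) * ennreal (l powr s) = 1"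
      using l by (simp add: weight_mult)
    moreover have "ennreal (l powr (- s)) * (ennreal C * ennreal (c powr s))
      = ennreal (C * 4 powr s) * ennreal (t powr (- s))"
    proof -
      have "l powr (- s) * (C * c powr s) = (C * 4 powr s) * t powr (- s)"
        using ct by (simp add: l_def powr_divide powr_mult powr_minus field_simps)
      then show ?thesis using C(1) by (simp flip: ennreal_mult)
    qed
    ultimately show "(\<integral>\<^sup>+x. ennreal (w x) * indicator {ennreal ((c *
      t / 4) powr r)<..} (\<Sum>k. ce k (?g k) x powe r) \<partial>M)
        \<le> ennreal (C * 4 powr s) * (ennreal (t powr (- s)) *
           (\<integral>\<^sup>+x. ((\<Sum>k. g k x powe r) powe (1 / r) / ennreal c) powe s * indicator E x *
             ennreal (w x) \<partial>M))"
      unfolding l_def[symmetric] P_def[symmetric] by (simp add: mult.assoc[symmetric])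
  qed
qed

text \<open>The sequence is cut according to whether \<open>f\<close> exceeds \<open>t\<close>, and
  each part is estimated with its own exponent. Additivity of conditional expectation bounds the
  full sum by \<open>2 powr r * (S1 + S2)\<close>, so a large sum forces one of the two parts to be
  large.\<close>

lemma vector_weak_split:
  assumes s: "1 < s1" "s1 \<noteq> r" "1 < s2" "s2 \<noteq> r" and r: "1 < r" and K: "0 < K1" "0 < K2"
  obtains A where "0 < A"
    "\<And>w g c t. \<lbrakk>A_weight s1 K1 w; A_weight s2 K2 w; (\<integral>\<^sup>+x. ennreal (w x) \<partial>M) < top; \<And>k. g k \<in>
      borel_measurable M;
       AE x in M. (\<Sum>k. g k x powe r) \<noteq> top; 0 < c; 0 < t\<rbrakk> \<Longrightarrow>
      (\<integral>\<^sup>+x. ennreal (w x) * indicator {ennreal t<..} ((\<Sum>k. ce k (g k) x powe r) powe (1 / r) /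
        ennreal c) \<partial>M)
        \<le> ennreal A * (
         ennreal (t powr (- s1)) * (\<integral>\<^sup>+x. ((\<Sum>k. g k x powe r) powe (1 / r) / ennreal c) powe s1 *
            indicator {ennreal t<..} ((\<Sum>k. g k x powe r) powe (1 / r) / ennreal c) * ennreal (w x) \<partial>M) +
         ennreal (t powr (- s2)) * (\<integral>\<^sup>+x. ((\<Sum>k. g k x powe r) powe (1 / r) / ennreal c) powe s2 *
            indicator {..ennreal t} ((\<Sum>k. g k x powe r) powe (1 / r) / ennreal c) * ennreal (w x) \<partial>M))"
proof -
  obtain C1 where C1: "0 < C1"
    "\<And>w g E c t. \<lbrakk>A_weight s1 K1 w; (\<integral>\<^sup>+x. ennreal (w x) \<partial>M) < top; \<And>k. g k \<in> borel_measurable M;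
       AE x in M. (\<Sum>k. g k x powe r) \<noteq> top; E \<in> sets M; 0 < c; 0 < t\<rbrakk> \<Longrightarrow>
      (\<integral>\<^sup>+x. ennreal (w x) * indicator {ennreal ((c * t / 4) powr r)<..} (\<Sum>k. ce k (\<lambda>x. g k x *
        indicator E x) x powe r) \<partial>M)
        \<le> ennreal C1 * (ennreal (t powr (- s1)) *
           (\<integral>\<^sup>+x. ((\<Sum>k. g k x powe r) powe (1 / r) / ennreal c) powe s1 * indicator E x *
             ennreal (w x) \<partial>M))"
    using vector_weak_restricted[OF s(1) r s(2) K(1)] by blast
  obtain C2 where C2: "0 < C2"
    "\<And>w g E c t. \<lbrakk>A_weight s2 K2 w; (\<integral>\<^sup>+x. ennreal (w x) \<partial>M) < top; \<And>k. g k \<in> borel_measurable M;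
       AE x in M. (\<Sum>k. g k x powe r) \<noteq> top; E \<in> sets M; 0 < c; 0 < t\<rbrakk> \<Longrightarrow>
      (\<integral>\<^sup>+x. ennreal (w x) * indicator {ennreal ((c * t / 4) powr r)<..} (\<Sum>k. ce k (\<lambda>x. g k x *
        indicator E x) x powe r) \<partial>M)
        \<le> ennreal C2 * (ennreal (t powr (- s2)) *
           (\<integral>\<^sup>+x. ((\<Sum>k. g k x powe r) powe (1 / r) / ennreal c) powe s2 * indicator E x *
             ennreal (w x) \<partial>M))"
    using vector_weak_restricted[OF s(3) r s(4) K(2)] by blast
  show thesis
  proof (rule that[of "max C1 C2"])
    show "0 < max C1 C2" using C1 by simp
    fix w :: "'a \<Rightarrow> real" and g :: "nat \<Rightarrow> 'a \<Rightarrow> ennreal" and c t :: real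
    assume w: "A_weight s1 K1 w" "A_weight s2 K2 w" and wfin: "(\<integral>\<^sup>+x. ennreal (w x) \<partial>M) < top"
      and [measurable]: "\<And>k. g k \<in> borel_measurable M"
      and fin: "AE x in M. (\<Sum>k. g k x powe r) \<noteq> top" and ct: "0 < c" "0 < t"
    note [measurable] = A_weightD(1)[OF w(1)]
    define f where "f x = (\<Sum>k. g k x powe r) powe (1 / r) / ennreal c" for x
    have [measurable]: "f \<in> borel_measurable M" unfolding f_def by measurable
    define E where "E = {x \<in> space M. ennreal t < f x}"
    define E' where "E' = {x \<in> space M. f x \<le> ennreal t}"
    have [measurable]: "E \<in> sets M" "E' \<in> sets M" unfolding E_def E'_def by measurable
    define S where "S x = (\<Sum>k. ce k (g k) x powe r)" for x
    define S1 where "S1 x = (\<Sum>k. ce k (\<lambda>x. g k x * indicator E x) x powe r)" for x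
    define S2 where "S2 x = (\<Sum>k. ce k (\<lambda>x. g k x * indicator E' x) x powe r)" for x
    have [measurable]: "S1 \<in> borel_measurable M" "S2 \<in> borel_measurable M" unfolding S1_def S2_def
      by measurable
    define l where "l = (c * t / 4) powr r"
    have "AE x in M. ce k (g k) x = ce k (\<lambda>x. g k x * indicator E x) x + ce k (\<lambda>x. g k x *
      indicator E' x) x" for k
    proof -
      have "AE x in M. ce k (g k) x = ce k (\<lambda>x. g k x * indicator E x + g k x * indicator E' x) x"
        by (rule ce_cong, rule AE_I2) (auto simp: E_def E'_def split: split_indicator)
      moreover have "AE x in M. ce k (\<lambda>x. g k x * indicator E x) x + ce k (\<lambda>x. g k x * indicator E' x) x
         = ce k (\<lambda>x. g k x * indicator E x + g k x * indicator E' x) x"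
        by (rule ce_sum) measurable
      ultimately show ?thesis by eventually_elim simp
    qed
    then have "AE x in M. \<forall>k. ce k (g k) x = ce k (\<lambda>x. g k x * indicator E x) x + ce k (\<lambda>x. g k x *
      indicator E' x) x"
      by (simp add: AE_all_countable)
    then have "AE x in M. ennreal (w x) * indicator {ennreal t<..} (S x powe (1 / r) / ennreal c)
       \<le> ennreal (w x) * indicator {ennreal l<..} (S1 x) + ennreal (w x) *
         indicator {ennreal l<..} (S2 x)"
    proof eventually_elim
      case (elim x)
      have "S x \<le> (\<Sum>k. ennreal (2 powr r) * (ce k (\<lambda>x. g k x * indicator E x) x powe r
        + ce k (\<lambda>x. g k x * indicator E' x) x powe r))"
        unfolding S_def using elim r by (intro suminf_le) (auto intro: powe_sum_le)
      also have "\<dots> = ennreal (2 powr r) * (S1 x + S2 x)"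
        unfolding S1_def S2_def by (simp add: suminf_add[symmetric])
      finally have S: "S x \<le> ennreal (2 powr r) * (S1 x + S2 x)" .
      have "ennreal l < S1 x \<or> ennreal l < S2 x" if less: "ennreal t < S x powe (1 / r) / ennreal c"
      proof (rule ccontr)
        assume "\<not> ?thesis"
        then have "S1 x \<le> ennreal l" "S2 x \<le> ennreal l" by auto
        then have "S x \<le> ennreal (2 powr r) * (ennreal l + ennreal l)"
          using S by (meson add_mono mult_left_mono order_trans zero_le)
        also have "\<dots> = ennreal (2 powr r * (2 * l))"
          by (simp add: l_def ennreal_mult flip: ennreal_plus)
        also have "\<dots> \<le> ennreal ((c * t) powr r)"
        proof (rule ennreal_leI)
          \<comment> \<open>By \<open>1 < r\<close> the total loss \<open>2 * 2 powr r\<close> is at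
            most \<open>4 powr r\<close>, which the quarter in the level \<open>l\<close>
            absorbs.\<close>
          have "2 * 2 powr r \<le> 2 powr r * (2 powr r :: real)"
            using r powr_mono[of 1 r 2] by (intro mult_right_mono) auto
          also have "\<dots> = 4 powr r" by (simp flip: powr_mult)
          finally have "2 * 2 powr r / 4 powr r \<le> (1 :: real)" by simp
          then have "(2 * 2 powr r / 4 powr r) * (c * t) powr r \<le> 1 * (c * t) powr r"
            by (rule mult_right_mono) simp
          then show "2 powr r * (2 * l) \<le> (c * t) powr r"
            using ct by (simp add: l_def powr_divide mult_ac)
        qed
        finally have "S x powe (1 / r) \<le> ennreal ((c * t) powr r) powe (1 / r)"
          using r by (intro powe_mono) auto
        also have "\<dots> = ennreal t * ennreal c"
          using r ct by (simp add: ennreal_powe powr_powr ennreal_mult mult.commute)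
        finally have "S x powe (1 / r) / ennreal c \<le> ennreal t * ennreal c / ennreal c"
          by (rule divide_right_mono_ennreal)
        then show False using less ct mult_divide_eq_ennreal[of "ennreal c" "ennreal t"] by simp
      qed
      then show ?case by (auto split: split_indicator)
    qed
    then have "(\<integral>\<^sup>+x. ennreal (w x) * indicator {ennreal t<..} (S x powe (1 / r) / ennreal c) \<partial>M)
       \<le> (\<integral>\<^sup>+x. ennreal (w x) * indicator {ennreal l<..} (S1 x) + ennreal (w x) *
         indicator {ennreal l<..} (S2 x) \<partial>M)"
      by (rule nn_integral_mono_AE)
    also have "\<dots> = (\<integral>\<^sup>+x. ennreal (w x) * indicator {ennreal l<..} (S1 x) \<partial>M) + (\<integral>\<^sup>+x. ennreal (w x) *
      indicator {ennreal l<..} (S2 x) \<partial>M)"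
      by (rule nn_integral_add) measurable
    also have "\<dots> \<le> ennreal C1 * (ennreal (t powr (- s1)) * (\<integral>\<^sup>+x. f x powe s1 * indicator E x *
      ennreal (w x) \<partial>M))
        + ennreal C2 * (ennreal (t powr (- s2)) * (\<integral>\<^sup>+x. f x powe s2 * indicator E' x *
          ennreal (w x) \<partial>M))"
      unfolding S1_def S2_def l_def f_def
      using w wfin fin ct by (intro add_mono C1(2) C2(2)) auto
    also have "\<dots> \<le> ennreal (max C1 C2) * (ennreal (t powr (- s1)) * (\<integral>\<^sup>+x. f x powe s1 *
      indicator E x * ennreal (w x) \<partial>M))
        + ennreal (max C1 C2) * (ennreal (t powr (- s2)) * (\<integral>\<^sup>+x. f x powe s2 * indicator E' x *
          ennreal (w x) \<partial>M))"
      by (intro add_mono mult_right_mono ennreal_leI) auto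
    also have "(\<integral>\<^sup>+x. f x powe s1 * indicator E x * ennreal (w x) \<partial>M)
       = (\<integral>\<^sup>+x. f x powe s1 * indicator {ennreal t<..} (f x) * ennreal (w x) \<partial>M)"
      by (rule nn_integral_cong) (auto simp: E_def split: split_indicator)
    also have "(\<integral>\<^sup>+x. f x powe s2 * indicator E' x * ennreal (w x) \<partial>M)
       = (\<integral>\<^sup>+x. f x powe s2 * indicator {..ennreal t} (f x) * ennreal (w x) \<partial>M)"
      by (rule nn_integral_cong) (auto simp: E'_def split: split_indicator)
    finally show "(\<integral>\<^sup>+x. ennreal (w x) * indicator {ennreal t<..} ((\<Sum>k. ce k (g k) x powe r) powe (1 /
      r) / ennreal c) \<partial>M)
        \<le> ennreal (max C1 C2) * (
         ennreal (t powr (- s1)) * (\<integral>\<^sup>+x. ((\<Sum>k. g k x powe r) powe (1 / r) / ennreal c) powe s1 *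
            indicator {ennreal t<..} ((\<Sum>k. g k x powe r) powe (1 / r) / ennreal c) * ennreal (w x) \<partial>M) +
         ennreal (t powr (- s2)) * (\<integral>\<^sup>+x. ((\<Sum>k. g k x powe r) powe (1 / r) / ennreal c) powe s2 *
            indicator {..ennreal t} ((\<Sum>k. g k x powe r) powe (1 / r) / ennreal c) * ennreal (w x) \<partial>M))"
      unfolding S_def f_def by (simp add: distrib_left)
  qed
qed

text \<open>The exponents \<open>s1 < p\<close> and \<open>s2 > p'\<close> both exceed
  \<open>q\<close>, so at each of them all weights \<open>\<lambda>x. \<phi> x t\<close> satisfy the
  Muckenhoupt condition with a constant independent of \<open>t\<close>, and the split weak
  inequality feeds \<open>dyadic_interpolation\<close>.\<close>

lemma vector_modular:
  assumes \<phi>: "musielak_orlicz M \<phi>" and A: "1 \<le> q" "MO_A M F q \<phi>"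
    and lower: "unif_lower_type M \<phi> p" and upper: "unif_upper_type M \<phi> p'" and "q < p" and r: "1 < r"
  obtains B where "0 < B"
    "\<And>g c. \<lbrakk>\<And>k. g k \<in> borel_measurable M; AE x in M. (\<Sum>k. g k x powe r) \<noteq> top; 0 < c\<rbrakk> \<Longrightarrow>
      (\<integral>\<^sup>+x. dyadic_modular \<phi> x ((\<Sum>k. ce k (g k) x powe r) powe (1 / r) / ennreal c) \<partial>M)
        \<le> ennreal B * (\<integral>\<^sup>+x. MO_ext \<phi> x ((\<Sum>k. g k x powe r) powe (1 / r) / ennreal c) \<partial>M)"
proof -
  obtain c1 where c1: "0 < c1" "\<And>x t s. x \<in> space M \<Longrightarrow> 0 \<le> t \<Longrightarrow> 0 < s \<Longrightarrow> s < 1 \<Longrightarrow>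
        \<phi> x (s * t) \<le> c1 * s powr p * \<phi> x t"
    using lower unfolding unif_lower_type_def by blast
  obtain c2 where c2: "0 < c2" "\<And>x t s. x \<in> space M \<Longrightarrow> 0 \<le> t \<Longrightarrow> 1 \<le> s \<Longrightarrow>
        \<phi> x (s * t) \<le> c2 * s powr p' * \<phi> x t"
    using upper unfolding unif_upper_type_def by blast
  have nn: "\<And>x t. x \<in> space M \<Longrightarrow> 0 \<le> t \<Longrightarrow> 0 \<le> \<phi> x t"
    and meas: "\<And>t. 0 < t \<Longrightarrow> (\<lambda>x. \<phi> x t) \<in> borel_measurable M"
    and int: "\<And>t. 0 < t \<Longrightarrow> integrable M (\<lambda>x. \<phi> x t)"
    using \<phi> by (auto simp: musielak_orlicz_def)
  have wfin: "(\<integral>\<^sup>+x. ennreal (\<phi> x t) \<partial>M) < top" if "0 < t" for t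
  proof -
    have "(\<integral>\<^sup>+x. ennreal (\<phi> x t) \<partial>M) = (\<integral>\<^sup>+x. ennreal (norm (\<phi> x t)) \<partial>M)"
      using nn that by (intro nn_integral_cong) auto
    also have "\<dots> < top" using int[OF that] by (simp add: integrable_iff_bounded)
    finally show ?thesis .
  qed
  \<comment> \<open>The midpoint of \<open>q\<close> and \<open>p\<close> is moved when it coincides
    with \<open>r\<close>, an exponent excluded in \<open>vector_weak_split\<close>.\<close>
  obtain s1 where s1: "q < s1" "s1 < p" "s1 \<noteq> r"
  proof (cases "(q + p) / 2 = r")
    case True
    then show thesis using \<open>q < p\<close> by (intro that[of "(q + r) / 2"]) auto
  next
    case False
    then show thesis using \<open>q < p\<close> by (intro that[of "(q + p) / 2"]) auto
  qed
  \<comment> \<open>Large enough to exceed the upper type, \<open>r\<close> and \<open>q\<close> at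
    once.\<close>
  define s2 where "s2 = max (max p' r) q + 1"
  have s2: "p' < s2" "q < s2" "s2 \<noteq> r" by (auto simp: s2_def)
  obtain K1 where K1: "0 < K1" "\<And>t. 0 < t \<Longrightarrow> A_weight s1 K1 (\<lambda>x. \<phi> x t)"
    using MO_A_imp_A_weight[OF \<phi> A(1) s1(1) A(2)] by blast
  obtain K2 where K2: "0 < K2" "\<And>t. 0 < t \<Longrightarrow> A_weight s2 K2 (\<lambda>x. \<phi> x t)"
    using MO_A_imp_A_weight[OF \<phi> A(1) s2(2) A(2)] by blast
  have gt1: "1 < s1" "1 < s2" using s1 s2 A(1) by auto
  from vector_weak_split[OF gt1(1) s1(3) gt1(2) s2(3) r K1(1) K2(1)]
  obtain A where A: "0 < A"
    "\<And>w g c t. \<lbrakk>A_weight s1 K1 w; A_weight s2 K2 w; (\<integral>\<^sup>+x. ennreal (w x) \<partial>M) < top; \<And>k. g k \<in>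
      borel_measurable M;
       AE x in M. (\<Sum>k. g k x powe r) \<noteq> top; 0 < c; 0 < t\<rbrakk> \<Longrightarrow>
      (\<integral>\<^sup>+x. ennreal (w x) * indicator {ennreal t<..} ((\<Sum>k. ce k (g k) x powe r) powe (1 / r) /
        ennreal c) \<partial>M)
        \<le> ennreal A * (
         ennreal (t powr (- s1)) * (\<integral>\<^sup>+x. ((\<Sum>k. g k x powe r) powe (1 / r) / ennreal c) powe s1 *
            indicator {ennreal t<..} ((\<Sum>k. g k x powe r) powe (1 / r) / ennreal c) * ennreal (w x) \<partial>M) +
         ennreal (t powr (- s2)) * (\<integral>\<^sup>+x. ((\<Sum>k. g k x powe r) powe (1 / r) / ennreal c) powe s2 *
            indicator {..ennreal t} ((\<Sum>k. g k x powe r) powe (1 / r) / ennreal c) * ennreal (w x) \<partial>M))"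
    by blast
  define B where "B = A * (c1 / (1 - 2 powr (s1 - p)) + c2 / (1 - 2 powr (p' - s2)))"
  show thesis
  proof (rule that[of B])
    show "0 < B" unfolding B_def
      using A(1) c1(1) c2(1) s1 s2 by (intro mult_pos_pos add_pos_pos divide_pos_pos) (auto simp:
        powr_less_one)
    fix g :: "nat \<Rightarrow> 'a \<Rightarrow> ennreal" and c :: real
    assume [measurable]: "\<And>k. g k \<in> borel_measurable M" and fin: "AE x in M. (\<Sum>k. g k x powe r) \<noteq> top"
      and c: "0 < c"
    show "(\<integral>\<^sup>+x. dyadic_modular \<phi> x ((\<Sum>k. ce k (g k) x powe r) powe (1 / r) / ennreal c) \<partial>M)
        \<le> ennreal B * (\<integral>\<^sup>+x. MO_ext \<phi> x ((\<Sum>k. g k x powe r) powe (1 / r) / ennreal c) \<partial>M)"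
      unfolding B_def
    proof (rule dyadic_interpolation)
      show "AE x in M. (\<Sum>k. g k x powe r) powe (1 / r) / ennreal c \<noteq> top"
        using fin by eventually_elim (use c in \<open>auto simp: ennreal_divide_eq_top_iff\<close>)
      fix j :: int
      have t: "0 < 2 powr real_of_int j" by simp
      have e: "(2 powr real_of_int j) powr (- s) = 2 powr (- s * j)" for s
        by (simp add: powr_powr mult.commute)
      show "(\<integral>\<^sup>+x. ennreal (\<phi> x (2 powr j)) *
        indicator {ennreal (2 powr j)<..} ((\<Sum>k. ce k (g k) x powe r) powe (1 / r) / ennreal c) \<partial>M)
        \<le> ennreal A * (
         ennreal (2 powr (- s1 * j)) * (\<integral>\<^sup>+x. ((\<Sum>k. g k x powe r) powe (1 / r) / ennreal c) powe s1 *
            indicator {ennreal (2 powr j)<..} ((\<Sum>k. g k x powe r) powe (1 / r) / ennreal c) *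
              ennreal (\<phi> x (2 powr j)) \<partial>M) +
         ennreal (2 powr (- s2 * j)) * (\<integral>\<^sup>+x. ((\<Sum>k. g k x powe r) powe (1 / r) / ennreal c) powe s2 *
            indicator {..ennreal (2 powr j)} ((\<Sum>k. g k x powe r) powe (1 / r) / ennreal c) *
              ennreal (\<phi> x (2 powr j)) \<partial>M))"
        unfolding e[symmetric] by (rule A(2)[OF K1(2)[OF t] K2(2)[OF t] wfin[OF t] _ fin c t])
          measurable
    qed (use nn meas c1 c2 s1 s2 A in auto)
  qed
qed

end

section \<open>From modulars to Luxemburg norms\<close>

lemma MO_ext_scale:
  assumes lower: "\<And>t s. 0 \<le> t \<Longrightarrow> 0 < s \<Longrightarrow> s < 1 \<Longrightarrow> \<phi> x (s * t) \<le> c * s powr p * \<phi> x t"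
    and "0 < c" "1 < L" "0 < d"
  shows "MO_ext \<phi> x (t / ennreal (L * d)) \<le> ennreal (c * L powr (- p)) * MO_ext \<phi> x (t / ennreal d)"
proof (cases "t = top")
  case True
  then show ?thesis using assms by (simp add: MO_ext_def ennreal_mult_top ennreal_top_divide)
next
  case False
  then obtain u where u: "t = ennreal u" "0 \<le> u" by (cases t) auto
  have "\<phi> x (1 / L * (u / d)) \<le> c * (1 / L) powr p * \<phi> x (u / d)"
    using assms u by (intro lower) auto
  moreover have "(1 / L) powr p = L powr (- p)" using assms by (simp add: powr_divide powr_minus_divide)
  ultimately have "\<phi> x (u / (L * d)) \<le> c * L powr (- p) * \<phi> x (u / d)" by simp
  then show ?thesis
    using assms u by (simp add: MO_ext_def divide_ennreal ennreal_leI flip: ennreal_mult')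
qed

text \<open>Each \<open>c\<close> admissible for \<open>f\<close> makes \<open>L * c\<close>
  admissible for \<open>g\<close>. Dividing by \<open>L\<close> first turns the claim into a lower
  bound for an infimum, which also covers an empty set of admissible values.\<close>

lemma lux_norm_le:
  assumes L: "0 < L" and le: "\<And>c. 0 < c \<Longrightarrow> (\<integral>\<^sup>+ x. MO_ext \<phi> x (f x / ennreal c) \<partial>M) \<le> 1 \<Longrightarrow>
     (\<integral>\<^sup>+ x. MO_ext \<phi> x (g x / ennreal (L * c)) \<partial>M) \<le> 1"
  shows "lux_norm M \<phi> g \<le> ennreal L * lux_norm M \<phi> f"
proof -
  have "lux_norm M \<phi> g / ennreal L \<le> lux_norm M \<phi> f"
    unfolding lux_norm_def[of M \<phi> f]
  proof (rule Inf_greatest, clarify)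
    fix c :: real
    assume c: "0 < c" "(\<integral>\<^sup>+ x. MO_ext \<phi> x (f x / ennreal c) \<partial>M) \<le> 1"
    have "lux_norm M \<phi> g \<le> ennreal (L * c)"
      unfolding lux_norm_def by (rule Inf_lower) (use le[OF c] c L in auto)
    then have "lux_norm M \<phi> g / ennreal L \<le> ennreal (L * c) / ennreal L"
      by (rule divide_right_mono_ennreal)
    also have "\<dots> = ennreal c" using L c by (simp add: divide_ennreal)
    finally show "lux_norm M \<phi> g / ennreal L \<le> ennreal c" .
  qed
  then have "lux_norm M \<phi> g / ennreal L * ennreal L \<le> lux_norm M \<phi> f * ennreal L"
    by (rule mult_right_mono) simp
  then show ?thesis using L by (simp add: ennreal_divide_mult_cancel) (simp add: mult.commute)
qed

theorem theorem3p14: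
  fixes M :: "'a measure" and F :: "nat \<Rightarrow> 'a measure"
    and \<phi> :: "'a \<Rightarrow> real \<Rightarrow> real" and p_minus p_plus r :: real
  assumes "prob_space M"
    and "\<And>n. subalgebra M (F n)"
    and "filtration (space M) F"
    and "musielak_orlicz M \<phi>"
    and "MO_A_infty M F \<phi>"
    and "unif_lower_type M \<phi> p_minus"
    and "unif_upper_type M \<phi> p_plus"
    and "crit_index M F \<phi> < p_minus"
    and "p_minus \<le> p_plus"
    and "1 < r"
  shows "\<exists>C>0. \<forall>g :: nat \<Rightarrow> 'a \<Rightarrow> real.
           (\<forall>k. g k \<in> borel_measurable M) \<longrightarrow> (\<forall>k. \<forall>x\<in>space M. 0 \<le> g k x) \<longrightarrow>
           lux_norm M \<phi> (\<lambda>x. enn_rpow (\<Sum>k. enn_rpow (nn_cond_exp M (F k) (\<lambda>y. ennreal (g k y)) x) r) (1 / r))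
             \<le> ennreal C * lux_norm M \<phi> (\<lambda>x. enn_rpow (\<Sum>k. ennreal (g k x powr r)) (1 / r))"
proof -
  interpret filtered_prob_space M F
    using assms(1-3) by (simp add: filtered_prob_space_def filtered_prob_space_axioms_def)
  note \<phi> = assms(4)
  have "{q. 1 \<le> q \<and> MO_A M F q \<phi>} \<noteq> {}" using assms(5) by (auto simp: MO_A_infty_def)
  \<comment> \<open>The set of exponents is nonempty and its infimum lies below
    \<open>p_minus\<close>, so some member does too.\<close>
  then obtain q where q: "1 \<le> q" "MO_A M F q \<phi>" "q < p_minus"
    using assms(8) unfolding crit_index_def by (metis (no_types, lifting) cInf_lessD mem_Collect_eq)
  obtain B where B: "0 < B"
    "\<And>g c. \<lbrakk>\<And>k. g k \<in> borel_measurable M; AE x in M. (\<Sum>k. g k x powe r) \<noteq> top; 0 < c\<rbrakk> \<Longrightarrow>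
      (\<integral>\<^sup>+x. dyadic_modular \<phi> x ((\<Sum>k. ce k (g k) x powe r) powe (1 / r) / ennreal c) \<partial>M)
        \<le> ennreal B * (\<integral>\<^sup>+x. MO_ext \<phi> x ((\<Sum>k. g k x powe r) powe (1 / r) / ennreal c) \<partial>M)"
    using vector_modular[OF \<phi> q(1,2) assms(6,7) q(3) assms(10)] by blast
  obtain c1 where c1: "0 < c1" "\<And>x t s. x \<in> space M \<Longrightarrow> 0 \<le> t \<Longrightarrow> 0 < s \<Longrightarrow> s < 1 \<Longrightarrow>
        \<phi> x (s * t) \<le> c1 * s powr p_minus * \<phi> x t"
    using assms(6) unfolding unif_lower_type_def by blast
  obtain c2 where c2: "0 < c2" "\<And>x t s. x \<in> space M \<Longrightarrow> 0 \<le> t \<Longrightarrow> 1 \<le> s \<Longrightarrow>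
        \<phi> x (s * t) \<le> c2 * s powr p_plus * \<phi> x t"
    using assms(7) unfolding unif_upper_type_def by blast
  have p: "0 < p_minus" using q by simp
  \<comment> \<open>The losses between the two modulars: \<open>c1\<close> from the lower type,
    \<open>c2 * 2 powr p_plus\<close> from the comparison with \<open>dyadic_modular\<close>, and
    \<open>B\<close> from interpolation.\<close>
  define R where "R = c1 * (c2 * 2 powr p_plus) * B"
  \<comment> \<open>Enlarging the norm parameter by \<open>L\<close> gains
    \<open>L powr (- p_minus)\<close> by the lower type. This choice makes the gain outweigh
    \<open>R\<close>, and the value \<open>2\<close> secures \<open>L > 1\<close> for
    \<open>MO_ext_scale\<close>.\<close>
  define L where "L = max 2 (R powr (1 / p_minus))"
  have L: "1 < L" by (simp add: L_def)
  have R: "0 < R" using c1 c2 B by (simp add: R_def)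
  have "R = (R powr (1 / p_minus)) powr p_minus" using p R by (simp add: powr_powr)
  also have "\<dots> \<le> L powr p_minus" using p by (intro powr_mono2) (auto simp: L_def)
  finally have "R * L powr (- p_minus) \<le> L powr p_minus * L powr (- p_minus)"
    by (rule mult_right_mono) simp
  then have RL: "R * L powr (- p_minus) \<le> 1" using L by (simp flip: powr_add)
  show ?thesis
  proof (intro exI[of _ L] conjI allI impI)
    show "0 < L" using L by simp
    fix g :: "nat \<Rightarrow> 'a \<Rightarrow> real"
    assume g: "\<forall>k. g k \<in> borel_measurable M" "\<forall>k. \<forall>x\<in>space M. 0 \<le> g k x"
    define G where "G k x = ennreal (g k x)" for k x
    have [measurable]: "g k \<in> borel_measurable M" for k using g(1) by blast
    have [measurable]: "G k \<in> borel_measurable M" for k unfolding G_def by measurable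
    define X where "X x = (\<Sum>k. ce k (G k) x powe r) powe (1 / r)" for x
    have [measurable]: "X \<in> borel_measurable M" unfolding X_def by measurable
    have "lux_norm M \<phi> X \<le> ennreal L * lux_norm M \<phi> (\<lambda>x. (\<Sum>k. ennreal (g k x powr r)) powe (1 / r))"
    proof (rule lux_norm_le)
      show "0 < L" using L by simp
      fix c :: real
      assume c: "0 < c" and le: "(\<integral>\<^sup>+ x. MO_ext \<phi> x ((\<Sum>k. ennreal (g k x powr r)) powe (1 / r) /
        ennreal c) \<partial>M) \<le> 1"
      define f where "f x = (\<Sum>k. G k x powe r) powe (1 / r) / ennreal c" for x
      have [measurable]: "f \<in> borel_measurable M" unfolding f_def by measurable
      have "(\<integral>\<^sup>+ x. MO_ext \<phi> x (f x) \<partial>M)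
         = (\<integral>\<^sup>+ x. MO_ext \<phi> x ((\<Sum>k. ennreal (g k x powr r)) powe (1 / r) / ennreal c) \<partial>M)"
        using g(2) by (intro nn_integral_cong) (simp add: f_def G_def ennreal_powe)
      with le have le: "(\<integral>\<^sup>+ x. MO_ext \<phi> x (f x) \<partial>M) \<le> 1" by simp
      \<comment> \<open>\<open>MO_ext\<close> is infinite at infinity, so a modular of at most one
        leaves \<open>f\<close> finite almost everywhere. A measurable minorant is used because the
        modular is possibly only a lower integral.\<close>
      have "(\<integral>\<^sup>+ x. top * indicator {x \<in> space M. f x = top} x \<partial>M) \<le> (\<integral>\<^sup>+ x. MO_ext \<phi> x (f x) \<partial>M)"
        by (intro nn_integral_mono) (auto simp: MO_ext_def split: split_indicator)
      also have "\<dots> < \<infinity>" using le by (simp add: order_le_less_trans)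
      finally have "AE x in M. top * indicator {x \<in> space M. f x = top} x \<noteq> (\<infinity> :: ennreal)"
        by (intro nn_integral_noteq_infinite) auto
      then have fin: "AE x in M. (\<Sum>k. G k x powe r) \<noteq> top"
        using AE_space by eventually_elim (use c in \<open>auto simp: f_def ennreal_divide_eq_top_iff split:
          split_indicator_asm\<close>)
      have meas: "\<And>t. 0 < t \<Longrightarrow> (\<lambda>x. \<phi> x t) \<in> borel_measurable M"
        using \<phi> by (auto simp: musielak_orlicz_def)
      \<comment> \<open>This measurability allows the constants to be taken out of the integral
        below.\<close>
      have [measurable]: "(\<lambda>x. dyadic_modular \<phi> x (X x / ennreal c)) \<in> borel_measurable M"
        by (rule borel_measurable_dyadic_modular[OF meas]) measurable
      have "(\<integral>\<^sup>+ x. MO_ext \<phi> x (X x / ennreal (L * c)) \<partial>M)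
         \<le> (\<integral>\<^sup>+ x. ennreal (c1 * L powr (- p_minus)) * (ennreal (c2 * 2 powr p_plus) *
           dyadic_modular \<phi> x (X x / ennreal c)) \<partial>M)"
      proof (rule nn_integral_mono)
        fix x assume x: "x \<in> space M"
        have "MO_ext \<phi> x (X x / ennreal (L * c))
          \<le> ennreal (c1 * L powr (- p_minus)) * MO_ext \<phi> x (X x / ennreal c)"
          using c1 x L c by (intro MO_ext_scale) auto
        also have "\<dots> \<le> ennreal (c1 * L powr (- p_minus)) * (ennreal (c2 * 2 powr p_plus) *
          dyadic_modular \<phi> x (X x / ennreal c))"
          using c2 x \<phi> by (intro mult_left_mono MO_ext_le_dyadic_modular) (auto simp:
            musielak_orlicz_def)
        finally show "MO_ext \<phi> x (X x / ennreal (L * c))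
          \<le> ennreal (c1 * L powr (- p_minus)) * (ennreal (c2 * 2 powr p_plus) *
            dyadic_modular \<phi> x (X x / ennreal c))" .
      qed
      also have "\<dots> = ennreal (c1 * L powr (- p_minus)) * (ennreal (c2 * 2 powr p_plus) *
        (\<integral>\<^sup>+ x. dyadic_modular \<phi> x (X x / ennreal c) \<partial>M))"
        by (simp add: nn_integral_cmult)
      also have "\<dots> \<le> ennreal (c1 * L powr (- p_minus)) * (ennreal (c2 * 2 powr p_plus) * (ennreal B *
        1))"
      proof (intro mult_left_mono)
        have "(\<integral>\<^sup>+ x. dyadic_modular \<phi> x (X x / ennreal c) \<partial>M)
          \<le> ennreal B * (\<integral>\<^sup>+ x. MO_ext \<phi> x (f x) \<partial>M)"
          unfolding X_def f_def by (rule B(2)[OF _ fin c]) measurable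
        also have "\<dots> \<le> ennreal B * 1" using le by (rule mult_left_mono) simp
        finally show "(\<integral>\<^sup>+ x. dyadic_modular \<phi> x (X x / ennreal c) \<partial>M) \<le> ennreal B * 1" .
      qed auto
      also have "\<dots> = ennreal (R * L powr (- p_minus))"
        using c1 c2 B(1) by (simp add: R_def ennreal_mult mult_ac)
      also have "\<dots> \<le> 1" using RL by simp
      finally show "(\<integral>\<^sup>+ x. MO_ext \<phi> x (X x / ennreal (L * c)) \<partial>M) \<le> 1" .
    qed
    then show "lux_norm M \<phi> (\<lambda>x. enn_rpow (\<Sum>k. enn_rpow (nn_cond_exp M (F k) (\<lambda>y. ennreal (g k y)) x)
      r) (1 / r))
       \<le> ennreal L * lux_norm M \<phi> (\<lambda>x. enn_rpow (\<Sum>k. ennreal (g k x powr r)) (1 / r))"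
      unfolding X_def G_def .
  qed
qed

end
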